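(* Let $\{x_n\}_{n\ge1}\subset[0,1]$ and $\{l_n\}_{n\ge1}\subset[0,+\infty)$ be two sequences of real numbers. Then for any $x\in(0,1]$, the set $$\mathcal{E}_x(\{x_n\},\{l_n\})=\{\beta>1\colon |T_\beta^n x-x_n|<\beta^{-l_n}\text{ for infinitely many }n\in\mathbb{N}\}$$ satisfies $$\mathcal{L}(\mathcal{E}_x(\{x_n\},\{l_n\}))=\beta^\star-1,$$ where $\beta^\star=\inf\{\beta>1\colon\sum_{n}\beta^{-l_n}<+\infty\}=\sup\{\beta>1\colon\sum_n\beta^{-l_n}=+\infty\}$.
   Context: $\mathbb{N}=\{1,2,\dots\}$ and $\mathcal{L}$ is Lebesgue measure. For $\beta>1$, the beta-transformation $T_\beta\colon[0,1]\to[0,1]$ is $T_\beta(x)=\beta x-\lfloor\beta x\rfloor$ for all $x\in[0,1]$ (including $x=1$); $T_\beta^n$ is its $n$-th iterate. In the definition of $\beta^\star$, the conventions are $\inf\varnothing=+\infty$ and $\sup\varnothing=1$. If $\beta^\star=+\infty$, the equality is understood to mean that $\mathcal{E}_x(\{x_n\},\{l_n\})$ is of full Lebesgue measure in $(1,+\infty)$. *)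

theory Defs
  imports "HOL-Analysis.Analysis"
begin

definition beta_T :: "real \<Rightarrow> real \<Rightarrow> real" where
  "beta_T b x = b * x - real_of_int \<lfloor>b * x\<rfloor>"

text \<open>Sequences indexed by the positive integers are functions on \<^typ>\<open>nat\<close> whose value
  at \<open>0\<close> is never used.\<close>

definition shrinking_params :: "real \<Rightarrow> (nat \<Rightarrow> real) \<Rightarrow> (nat \<Rightarrow> real) \<Rightarrow> real set" where
  "shrinking_params x xs l =
     {b. b > 1 \<and> infinite {n. n \<ge> 1 \<and> \<bar>(beta_T b ^^ n) x - xs n\<bar> < b powr (- l n)}}"

definition power_sum :: "(nat \<Rightarrow> real) \<Rightarrow> real \<Rightarrow> ennreal" where
  "power_sum l b = (\<Sum>n. ennreal (b powr (- l (Suc n))))"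

definition beta_star :: "(nat \<Rightarrow> real) \<Rightarrow> ereal" where
  "beta_star l = Inf (ereal ` {b. b > 1 \<and> power_sum l b < \<infinity>})"

text \<open>In \<^typ>\<open>ereal\<close> the infimum of the empty set is already \<open>\<infinity>\<close>, but its supremum is
  \<open>-\<infinity>\<close>, so the convention that it be \<open>1\<close> is imposed explicitly.\<close>

definition beta_star_sup :: "(nat \<Rightarrow> real) \<Rightarrow> ereal" where
  "beta_star_sup l =
     (let D = {b. b > 1 \<and> power_sum l b = \<infinity>} in if D = {} then 1 else Sup (ereal ` D))"

end

theory Submission
  imports Defs
begin

text \<open>Fix \<open>x \<in> (0,1]\<close> and regard the orbit point \<open>f n b = T_b^n x\<close> as a function of the base \<open>b\<close>. On each
interval of bases on which the first \<open>n\<close> digits of \<open>x\<close> are constant, \<open>f n\<close> is a polynomial, and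
\<open>f (n + 1) b = b * f n b - digit\<close> shows that its slope is comparable with \<open>b ^ n\<close>
(\<open>increments\<close>). So \<open>f n\<close> is a piecewise increasing map that behaves like the iterate of an
expanding map, and the theorem is a dynamical Borel--Cantelli lemma for it.

The bookkeeping uses zeros instead of digit words. A branch of \<open>f n\<close> starts where \<open>f n\<close> vanishes,
and because \<open>0\<close> is a fixed point of every \<open>T_b\<close> the sets \<open>Z n\<close> of zeros increase with \<open>n\<close>. A branch
starting at \<open>s\<close> contributes at most about \<open>r / s ^ n\<close> to the measure of the bases with
\<open>\<bar>f n b - z\<bar> < r\<close>, so everything depends on the sum of \<open>1 / s ^ n\<close> over the zeros \<open>s\<close> in an interval.
When \<open>n\<close> grows by one, the old zeros lose a factor \<open>1 / s < 1\<close>. A new zero \<open>t\<close> is a point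
at which the previous branch has climbed all the way to \<open>1\<close>, hence it is preceded by a gap of length at
least about \<open>1 / t ^ (n + 1)\<close>, and the new zeros contribute at most about the length of the
interval. This gives a bound uniform in \<open>n\<close> (\<open>cell_weight_le\<close>), whence the upper bounds for one
target (\<open>measure_hits_le\<close>) and, applied inside the pieces that hit an earlier target, for two
(\<open>measure_hits_Int_le\<close>).

The first of these and the Borel--Cantelli lemma settle the bases above the critical value
(\<open>almost_none_hit\<close>). Below it a lower bound of the same order is needed for arbitrary target
centres. Most bases have \<open>f n b\<close> not too small, by the upper bound for targets at \<open>0\<close>; boundedly many
further steps stretch such a branch over the whole unit interval (\<open>new_zero_exists\<close>), so branches
onto \<open>(0,1)\<close> occupy a positive proportion of every interval (\<open>eventually_new_zeros_sum_ge\<close>), and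
each of them meets every target (\<open>eventually_measure_hits_ge\<close>). The Chung--Erdos inequality turns
these estimates into a uniform positive proportion of hitting bases in every interval
(\<open>measure_limsup_ge\<close>), and a set whose complement has a uniform proportion of every interval is null
(\<open>null_if_complement_proportional\<close>).\<close>

section \<open>Real-variable preliminaries\<close>

text \<open>Two-sided control of increments is what the induction over orbit lengths produces; this
form saves taking absolute values there.\<close>

lemma continuous_on_if_increments:
  fixes g :: "real \<Rightarrow> real"
  assumes "\<And>a b. \<lbrakk>s \<le> a; a \<le> b; b \<le> t\<rbrakk> \<Longrightarrow> 0 \<le> g b - g a \<and> g b - g a \<le> K * (b - a)"
  shows "continuous_on {s..t} g"
proof (cases "s \<le> t")
  case True
  have "0 \<le> K" if "s < t"
  proof -
    have "0 \<le> K * (t - s)"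
      using assms[of s t] that by simp
    then show ?thesis using that by (simp add: zero_le_mult_iff)
  qed
  then have *: "dist (g a) (g b) \<le> max K 0 * dist a b" if "a \<in> {s..t}" "b \<in> {s..t}" for a b
    using assms[of a b] assms[of b a] that by (cases "a \<le> b"; cases "s < t") (auto simp: dist_real_def)
  have "(max K 0)-lipschitz_on {s..t} g"
    by (rule lipschitz_onI) (use * in auto)
  then show ?thesis by (rule lipschitz_on_continuous_on)
qed simp

lemma finite_if_separated:
  fixes A :: "real set"
  assumes "A \<subseteq> {u..v}" "0 < d" "\<And>s t. \<lbrakk>s \<in> A; t \<in> A; s < t\<rbrakk> \<Longrightarrow> d \<le> t - s"
  shows "finite A"
proof -
  let ?h = "\<lambda>a. \<lfloor>a / d\<rfloor>"
  have "inj_on ?h A"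
  proof (rule inj_onI, rule ccontr)
    fix a b assume ab: "a \<in> A" "b \<in> A" "?h a = ?h b" "a \<noteq> b"
    then have "d \<le> \<bar>a - b\<bar>"
      using assms(3)[of a b] assms(3)[of b a] by (cases "a < b") auto
    then have "1 \<le> \<bar>a / d - b / d\<bar>"
      using assms(2) by (simp add: diff_divide_distrib[symmetric] abs_divide)
    moreover have "\<bar>a / d - b / d\<bar> < 1"
      using ab(3) by linarith
    ultimately show False by simp
  qed
  moreover have "?h ` A \<subseteq> {\<lfloor>u / d\<rfloor>..\<lfloor>v / d\<rfloor>}"
    using assms(1,2) by (fastforce intro!: floor_mono divide_right_mono)
  ultimately show ?thesis
    by (meson finite_atLeastAtMost_int finite_imageD finite_subset)
qed

text \<open>Each weight but the first is paid for by the gap in front of its point. The gap in front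
of the first point may stick out of the interval to the left, which is why \<open>B\<close>
appears.\<close>

lemma sum_separated_le:
  fixes w :: "real \<Rightarrow> real"
  assumes "finite A" "0 < d" "0 \<le> B"
  shows "\<lbrakk>A \<subseteq> {u<..v}; u \<le> v; \<And>a. a \<in> A \<Longrightarrow> w a \<le> B;
     \<And>s t. \<lbrakk>s \<in> A; t \<in> A; s < t\<rbrakk> \<Longrightarrow> d * w t \<le> t - s\<rbrakk>
    \<Longrightarrow> sum w A \<le> (v - u) / d + B"
  using assms(1)
proof (induction A arbitrary: v rule: finite_linorder_max_induct)
  case empty
  then show ?case using assms by simp
next
  case (insert b A)
  show ?case
  proof (cases "A = {}")
    case True
    then have "w b \<le> B" using insert.prems by simp
    then show ?thesis using True insert.prems assms by (simp add: add_increasing)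
  next
    case False
    have m: "Max A \<in> A" using False insert.hyps by simp
    have "sum w A \<le> (Max A - u) / d + B"
    proof (rule insert.IH)
      show "A \<subseteq> {u<..Max A}" using insert.prems(1) insert.hyps by auto
      show "u \<le> Max A" using m insert.prems(1) by auto
    qed (use insert.prems in auto)
    moreover have "d * w b \<le> b - Max A"
      using insert.prems(4)[of "Max A" b] insert.hyps m by auto
    then have "w b \<le> (b - Max A) / d" using assms by (simp add: field_simps)
    moreover have "(b - Max A) / d + (Max A - u) / d \<le> (v - u) / d"
      using insert.prems(1) assms by (simp add: add_divide_distrib[symmetric] divide_right_mono)
    ultimately show ?thesis using insert.hyps by (subst sum.insert) auto
  qed
qed

lemma geometric_sum_le:
  assumes "1 < (t::real)"
  shows "(\<Sum>i<n. t ^ i) \<le> t ^ n / (t - 1)"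
  using assms by (simp add: geometric_sum divide_right_mono)

lemma scale_antimono:
  assumes "1 < (u::real)" "u \<le> t" "t \<le> v"
  shows "(u - 1) / v ^ n \<le> (t - 1) / t ^ n"
  using assms by (intro frac_le power_mono) auto

lemma arith_geometric_tendsto_0:
  assumes "1 < (p::real)"
  shows "(\<lambda>n. (real n + 1) / p ^ n) \<longlonglongrightarrow> 0" "(\<lambda>n. a / p ^ n) \<longlonglongrightarrow> 0"
proof -
  have p: "norm (1 / p) < 1" using assms by simp
  have 1: "(\<lambda>n. a * (1 / p) ^ n) \<longlonglongrightarrow> 0" for a
    using LIMSEQ_power_zero[OF p] tendsto_mult_right_zero by blast
  then show "(\<lambda>n. a / p ^ n) \<longlonglongrightarrow> 0" by (simp add: power_one_over)
  have "(\<lambda>n. real n * (1 / p) ^ n + 1 * (1 / p) ^ n) \<longlonglongrightarrow> 0 + 0"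
    by (intro tendsto_add 1 powser_times_n_limit_0 p)
  then show "(\<lambda>n. (real n + 1) / p ^ n) \<longlonglongrightarrow> 0"
    by (simp add: power_one_over add_divide_distrib)
qed

lemma summable_arith_geometric:
  assumes "1 < (p::real)"
  shows "summable (\<lambda>k. (real k + 1) / p ^ k)"
proof -
  have "norm (1 / p) < 1" using assms by simp
  then have "summable (\<lambda>k. of_nat (Suc k) * (1 / p) ^ k)"
    using geometric_deriv_sums sums_summable by blast
  then show ?thesis by (simp add: power_one_over add.commute)
qed

section \<open>Borel--Cantelli for quasi-independent sets\<close>

text \<open>Cauchy--Schwarz for the number \<open>S\<close> of sets that contain a point, against
the indicator of the union. It is read off from the nonnegativity of the integral of \<open>(S -
\<tau> 1_U)\<^sup>2\<close> at the best \<open>\<tau>\<close>.\<close>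

lemma Chung_Erdos:
  assumes "finite I" and A: "\<And>i. i \<in> I \<Longrightarrow> A i \<in> fmeasurable M"
  shows "(\<Sum>i\<in>I. measure M (A i))\<^sup>2
    \<le> measure M (\<Union>i\<in>I. A i) * (\<Sum>i\<in>I. \<Sum>j\<in>I. measure M (A i \<inter> A j))"
proof -
  let ?U = "\<Union>i\<in>I. A i"
  let ?S = "\<lambda>y. \<Sum>i\<in>I. indicat_real (A i) y"
  define a where "a = (\<Sum>i\<in>I. measure M (A i))"
  define Q where "Q = (\<Sum>i\<in>I. \<Sum>j\<in>I. measure M (A i \<inter> A j))"
  have U: "?U \<in> fmeasurable M" using assms by (intro fmeasurable.finite_UN) auto
  have AA: "A i \<inter> A j \<in> fmeasurable M" if "i \<in> I" "j \<in> I" for i j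
    using A[OF that(1)] A[OF that(2)] by (intro fmeasurable.Int)
  have int: "integrable M (indicat_real B)" "integral\<^sup>L M (indicat_real B) = measure M B"
    if "B \<in> fmeasurable M" for B
    using that by (auto simp: fmeasurable_def)
  \<comment> \<open>The integral of \<open>(S - \<tau> 1_U)\<^sup>2\<close>.\<close>
  have quad: "0 \<le> Q - 2 * \<tau> * a + \<tau>\<^sup>2 * measure M ?U" for \<tau>
  proof -
    have pt: "(\<Sum>i\<in>I. \<Sum>j\<in>I. indicat_real (A i \<inter> A j) y) - 2 * \<tau> * ?S y + \<tau>\<^sup>2 * indicat_real ?U y
        = (?S y - \<tau> * indicat_real ?U y)\<^sup>2" for y
    proof -
      have "(\<Sum>i\<in>I. \<Sum>j\<in>I. indicat_real (A i \<inter> A j) y) = ?S y * ?S y"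
        by (simp add: sum_product indicator_inter_arith)
      moreover have "?S y * indicat_real ?U y = ?S y"
        unfolding sum_distrib_right by (intro sum.cong) (auto simp: indicator_def)
      moreover have "indicat_real ?U y * indicat_real ?U y = indicat_real ?U y"
        by (cases "y \<in> ?U") simp_all
      moreover have "(?S y - \<tau> * indicat_real ?U y)\<^sup>2 = ?S y * ?S y
          - 2 * \<tau> * (?S y * indicat_real ?U y) + \<tau>\<^sup>2 * (indicat_real ?U y * indicat_real ?U y)"
        by (simp add: power2_eq_square algebra_simps)
      ultimately show ?thesis by (simp only:)
    qed
    have "0 \<le> (LINT y|M. (?S y - \<tau> * indicat_real ?U y)\<^sup>2)" by simp
    also have "\<dots> = (LINT y|M. (\<Sum>i\<in>I. \<Sum>j\<in>I. indicat_real (A i \<inter> A j) y) - 2 * \<tau> * ?S y + \<tau>\<^sup>2 * indicat_real ?U y)"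
      by (simp only: pt)
    also have "\<dots> = Q - 2 * \<tau> * a + \<tau>\<^sup>2 * measure M ?U"
      unfolding Q_def a_def using int(1)[OF U] int(2)[OF U] int(1)[OF A] int(2)[OF A] int(1)[OF AA] int(2)[OF AA]
      by (simp add: Bochner_Integration.integral_sum)
    finally show ?thesis .
  qed
  show ?thesis
  proof (cases "measure M ?U = 0")
    case True
    have "measure M (A i) \<le> measure M ?U" if "i \<in> I" for i
      using that A U by (intro measure_mono_fmeasurable) auto
    then have "measure M (A i) = 0" if "i \<in> I" for i
      using that True measure_nonneg[of M "A i"] by (metis order_antisym)
    then show ?thesis using True by simp
  next
    case False
    then have pos: "0 < measure M ?U" using measure_nonneg[of M ?U] by linarith
    have "0 \<le> Q - 2 * (a / measure M ?U) * a + (a / measure M ?U)\<^sup>2 * measure M ?U"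
      by (rule quad)
    also have "\<dots> = Q - a\<^sup>2 / measure M ?U"
      using pos by (simp add: power2_eq_square field_simps)
    finally have "a\<^sup>2 \<le> measure M ?U * Q" using pos by (simp add: field_simps)
    then show ?thesis by (simp add: a_def Q_def)
  qed
qed

text \<open>The sets are quasi-independent up to the summable correlation \<open>h\<close>. If
\<open>R\<close> is the sum of \<open>r\<close> over a long block, the correlations add only a
multiple of \<open>R\<close> to a second moment of order \<open>R\<^sup>2\<close>, so the
Chung--Erdos inequality bounds the measure of the union over every tail from below by the same
constant.\<close>

lemma measure_limsup_ge:
  fixes A :: "nat \<Rightarrow> 'a set" and r h :: "nat \<Rightarrow> real"
  assumes meas: "\<And>n. A n \<in> sets M" and sub: "\<And>n. A n \<subseteq> J" and J: "J \<in> fmeasurable M"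
    and r: "\<And>n. 0 \<le> r n" "\<not> summable r" and h: "\<And>k. 0 \<le> h k" "summable h"
    and ab: "0 < a" "0 < B"
    and lower: "eventually (\<lambda>n. a * r n \<le> measure M (A n)) sequentially"
    and pairs: "eventually (\<lambda>m. \<forall>k. measure M (A m \<inter> A (m + k)) \<le> B * r (m + k) * (r m + h k)) sequentially"
  shows "a\<^sup>2 / (4 * B) \<le> measure M (limsup A)"
proof -
  let ?c = "a\<^sup>2 / (4 * B)"
  let ?G = "suminf h"
  have A: "A n \<in> fmeasurable M" for n
    by (rule fmeasurableI2[OF J sub meas])
  have G: "0 \<le> ?G" using h by (simp add: suminf_nonneg)
  obtain N0 where N0: "\<And>n. N0 \<le> n \<Longrightarrow> a * r n \<le> measure M (A n)"
      "\<And>m k. N0 \<le> m \<Longrightarrow> measure M (A m \<inter> A (m + k)) \<le> B * r (m + k) * (r m + h k)"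
    using eventually_conj[OF lower pairs] unfolding eventually_sequentially by auto
  have tail: "?c \<le> measure M (\<Union>n\<in>{k..}. A n)" if "N0 \<le> k" for k
  proof -
    \<comment> \<open>The block is taken so long that \<open>R\<close> exceeds the total correlation.\<close>
    have unb: "\<exists>N. max 1 ?G < (\<Sum>i\<in>{k..<N}. r i)"
    proof (rule ccontr)
      assume "\<not> ?thesis"
      then have bd: "(\<Sum>i\<in>{k..<N}. r i) \<le> max 1 ?G" for N by (meson not_le)
      have "summable (\<lambda>i. r (i + k))"
      proof (rule summableI_nonneg_bounded)
        fix n
        have "(\<Sum>i<n. r (i + k)) = (\<Sum>i\<in>{0 + k..<n + k}. r i)"
          by (simp only: sum.shift_bounds_nat_ivl lessThan_atLeast0)
        then show "(\<Sum>i<n. r (i + k)) \<le> max 1 ?G" using bd[of "n + k"] by simp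
      qed (use r in simp)
      then show False using r(2) by (simp add: summable_iff_shift)
    qed
    then obtain N where N: "max 1 ?G < (\<Sum>i\<in>{k..<N}. r i)" by blast
    let ?I = "{k..<N}"
    define R where "R = (\<Sum>i\<in>?I. r i)"
    have R: "1 < R" "?G < R" using N by (auto simp: R_def)
    have pair_le: "measure M (A m \<inter> A n) \<le> B * (r m * r n) + B * (if m \<le> n then r n * h (n - m) else 0)
         + B * (if n \<le> m then r m * h (m - n) else 0)" if "m \<in> ?I" "n \<in> ?I" for m n
    proof (cases "m \<le> n")
      case True
      then have "measure M (A m \<inter> A n) \<le> B * r n * (r m + h (n - m))"
        using N0(2)[of m "n - m"] that \<open>N0 \<le> k\<close> by auto
      moreover have "0 \<le> B * (if n \<le> m then r m * h (m - n) else 0)"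
        using ab r h by simp
      ultimately show ?thesis using True by (simp only: if_True algebra_simps)
    next
      case False
      then have "measure M (A n \<inter> A m) \<le> B * r m * (r n + h (m - n))"
        using N0(2)[of n "m - n"] that \<open>N0 \<le> k\<close> by auto
      then show ?thesis using False by (simp add: algebra_simps Int_commute)
    qed
    have inner: "(\<Sum>m\<in>?I. if m \<le> n then r n * h (n - m) else 0) \<le> r n * ?G" if "n \<in> ?I" for n
    proof -
      have "(\<Sum>m\<in>?I. if m \<le> n then r n * h (n - m) else 0) = (\<Sum>m\<in>{k..n}. r n * h (n - m))"
        using that by (simp add: sum.If_cases, intro sum.cong) auto
      also have "\<dots> = r n * (\<Sum>m\<in>{k..n}. h (n - m))" by (rule sum_distrib_left[symmetric])
      also have "(\<Sum>m\<in>{k..n}. h (n - m)) = (\<Sum>j\<in>{..n - k}. h j)"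
        by (rule sum.reindex_bij_witness[of _ "\<lambda>j. n - j" "\<lambda>m. n - m"]) (use that in auto)
      also have "(\<Sum>j\<in>{..n - k}. h j) \<le> ?G"
        using h by (intro sum_le_suminf) auto
      finally show ?thesis using r by (simp add: mult_left_mono)
    qed
    have cross: "(\<Sum>m\<in>?I. \<Sum>n\<in>?I. if m \<le> n then r n * h (n - m) else 0) \<le> R * ?G"
    proof -
      have "(\<Sum>m\<in>?I. \<Sum>n\<in>?I. if m \<le> n then r n * h (n - m) else 0)
          = (\<Sum>n\<in>?I. \<Sum>m\<in>?I. if m \<le> n then r n * h (n - m) else 0)"
        by (rule sum.swap)
      also have "\<dots> \<le> (\<Sum>n\<in>?I. r n * ?G)" by (rule sum_mono[OF inner])
      finally show ?thesis by (simp add: R_def sum_distrib_right)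
    qed
    have "(\<Sum>m\<in>?I. \<Sum>n\<in>?I. measure M (A m \<inter> A n)) \<le> (\<Sum>m\<in>?I. \<Sum>n\<in>?I.
        B * (r m * r n) + B * (if m \<le> n then r n * h (n - m) else 0) + B * (if n \<le> m then r m * h (m - n) else 0))"
      by (intro sum_mono pair_le)
    also have "\<dots> = B * (R * R) + B * (\<Sum>m\<in>?I. \<Sum>n\<in>?I. if m \<le> n then r n * h (n - m) else 0)
        + B * (\<Sum>m\<in>?I. \<Sum>n\<in>?I. if n \<le> m then r m * h (m - n) else 0)"
      unfolding R_def sum_product by (simp only: sum.distrib sum_distrib_left)
    also have "(\<Sum>m\<in>?I. \<Sum>n\<in>?I. if n \<le> m then r m * h (m - n) else 0)
        = (\<Sum>m\<in>?I. \<Sum>n\<in>?I. if m \<le> n then r n * h (n - m) else 0)"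
      by (rule sum.swap)
    also have "B * (R * R) + B * (\<Sum>m\<in>?I. \<Sum>n\<in>?I. if m \<le> n then r n * h (n - m) else 0)
        + B * (\<Sum>m\<in>?I. \<Sum>n\<in>?I. if m \<le> n then r n * h (n - m) else 0)
       \<le> B * (R * R) + B * (R * R) + B * (R * R)"
    proof -
      have "R * ?G \<le> R * R" using R by (intro mult_left_mono) auto
      then have "(\<Sum>m\<in>?I. \<Sum>n\<in>?I. if m \<le> n then r n * h (n - m) else 0) \<le> R * R"
        using cross by linarith
      then have "B * (\<Sum>m\<in>?I. \<Sum>n\<in>?I. if m \<le> n then r n * h (n - m) else 0) \<le> B * (R * R)"
        by (rule mult_left_mono) (use ab in simp)
      then show ?thesis by linarith
    qed
    also have "\<dots> \<le> 4 * B * R\<^sup>2"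
    proof -
      have "0 \<le> B * (R * R)" using ab by simp
      then show ?thesis unfolding power2_eq_square by linarith
    qed
    finally have second: "(\<Sum>m\<in>?I. \<Sum>n\<in>?I. measure M (A m \<inter> A n)) \<le> 4 * B * R\<^sup>2" .
    have "a * R \<le> (\<Sum>n\<in>?I. measure M (A n))"
      unfolding R_def sum_distrib_left using N0(1) that by (intro sum_mono) auto
    then have "(a * R)\<^sup>2 \<le> (\<Sum>n\<in>?I. measure M (A n))\<^sup>2"
      using ab R by (intro power_mono) auto
    also have "\<dots> \<le> measure M (\<Union>n\<in>?I. A n) * (\<Sum>m\<in>?I. \<Sum>n\<in>?I. measure M (A m \<inter> A n))"
      using A by (intro Chung_Erdos) auto
    also have "\<dots> \<le> measure M (\<Union>n\<in>?I. A n) * (4 * B * R\<^sup>2)"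
      using second by (intro mult_left_mono) auto
    finally have "a\<^sup>2 * R\<^sup>2 \<le> (measure M (\<Union>n\<in>?I. A n) * (4 * B)) * R\<^sup>2"
      by (simp only: power_mult_distrib mult.assoc)
    then have "a\<^sup>2 \<le> measure M (\<Union>n\<in>?I. A n) * (4 * B)"
      by (rule mult_right_le_imp_le) (use R in simp)
    then have "?c \<le> measure M (\<Union>n\<in>?I. A n)"
      by (subst pos_divide_le_eq) (use ab in simp_all)
    also have "\<dots> \<le> measure M (\<Union>n\<in>{k..}. A n)"
    proof (rule measure_mono_fmeasurable)
      show "(\<Union>n\<in>{k..}. A n) \<in> fmeasurable M"
        using sub meas by (intro fmeasurableI2[OF J]) auto
    qed (use meas in auto)
    finally show ?thesis .
  qed
  let ?T = "\<lambda>k. \<Union>n\<in>{k..}. A n"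
  have T: "?T k \<in> fmeasurable M" for k
    using sub meas by (intro fmeasurableI2[OF J]) auto
  have "(\<lambda>k. measure M (?T k)) \<longlonglongrightarrow> measure M (\<Inter>k. ?T k)"
  proof (rule Lim_measure_decseq)
    show "range ?T \<subseteq> sets M" using T by auto
    show "decseq ?T" by (intro decseq_SucI UN_mono) auto
    show "emeasure M (?T k) \<noteq> \<infinity>" for k using T[of k] by (auto simp: fmeasurable_def)
  qed
  moreover have "(\<Inter>k. ?T k) = limsup A" by (auto simp: limsup_INF_SUP)
  moreover have "eventually (\<lambda>k. ?c \<le> measure M (?T k)) sequentially"
    using tail eventually_sequentially by blast
  ultimately show ?thesis
    by (intro tendsto_lowerbound[where f = "\<lambda>k. measure M (?T k)" and F = sequentially]) simp_all
qed

text \<open>A substitute for the Lebesgue density theorem: enclose \<open>N\<close> in an open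
set \<open>T\<close> of nearly the same measure and cover \<open>N\<close> by nonoverlapping intervals inside
\<open>T\<close>. The complement of \<open>N\<close> takes its share of each of them, which is more than
\<open>T - N\<close> can hold.\<close>

lemma null_if_complement_proportional:
  fixes N :: "real set"
  assumes N: "N \<in> sets lebesgue" "N \<subseteq> {p<..<q}" and "0 < c"
    and dense: "\<And>u v. \<lbrakk>p \<le> u; u < v; v \<le> q\<rbrakk> \<Longrightarrow> c * (v - u) \<le> measure lebesgue ({u<..<v} - N)"
  shows "N \<in> null_sets lebesgue"
proof (rule ccontr)
  assume "N \<notin> null_sets lebesgue"
  then have pos: "emeasure lebesgue N \<noteq> 0" using N by auto
  have Nl: "N \<in> lmeasurable"
    by (rule fmeasurableI2[of "{p..q}"]) (use N in auto)
  then have eN: "emeasure lebesgue N = ennreal (measure lebesgue N)"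
    by (rule emeasure_eq_measure2)
  with pos have mpos: "0 < measure lebesgue N"
    using measure_nonneg[of lebesgue N] by (auto simp: order_le_less)
  have "N \<noteq> {}" using mpos by auto
  then have pq: "p < q" using N by auto
  have "0 < c * measure lebesgue N" using mpos \<open>0 < c\<close> by simp
  then obtain T where T: "open T" "N \<subseteq> T" "T - N \<in> lmeasurable"
      "emeasure lebesgue (T - N) < ennreal (c * measure lebesgue N)"
    by (rule sets_lebesgue_outer_open[OF N(1)])
  \<comment> \<open>Every interval of the covering contains a point of \<open>N\<close>, so only the values of \<open>g\<close> there matter.\<close>
  define g where "g y = (if y \<in> T then T else UNIV)" for y
  have "gauge g" using T by (auto simp: gauge_def g_def)
  have box: "N \<subseteq> cbox p q" "box p q \<noteq> {}" using N pq by auto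
  obtain \<D> where D: "countable \<D>" "\<Union>\<D> \<subseteq> cbox p q"
    "\<And>K. K \<in> \<D> \<Longrightarrow> interior K \<noteq> {} \<and> (\<exists>c d. K = cbox c d)"
    "pairwise (\<lambda>A B. interior A \<inter> interior B = {}) \<D>"
    "\<And>K. K \<in> \<D> \<Longrightarrow> \<exists>y \<in> N \<inter> K. K \<subseteq> g y"
    "\<And>u v. cbox u v \<in> \<D> \<Longrightarrow> \<exists>n. \<forall>i\<in>Basis. v \<bullet> i - u \<bullet> i = (q \<bullet> i - p \<bullet> i) / 2 ^ n"
    "N \<subseteq> \<Union>\<D>"
    by (rule covering_lemma[OF box \<open>gauge g\<close>]) presburger
  have KT: "K \<subseteq> T" if "K \<in> \<D>" for K
  proof -
    obtain y where "y \<in> N" "K \<subseteq> g y" using D(5)[OF \<open>K \<in> \<D>\<close>] by blast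
    then show ?thesis using T(2) by (auto simp: g_def split: if_splits)
  qed
  have disj: "disjoint_family_on interior \<D>"
    using D(4) by (auto simp: disjoint_family_on_def pairwise_def)
  have disjN: "disjoint_family_on (\<lambda>K. interior K - N) \<D>"
    using disj by (auto simp: disjoint_family_on_def)
  have bdry: "\<Union>((\<lambda>K. K - interior K) ` \<D>) \<in> null_sets lebesgue"
  proof (intro null_sets_UN' D(1))
    fix K assume "K \<in> \<D>"
    then obtain u v where "K = cbox u v" using D(3) by blast
    then have "K - interior K \<subseteq> {u, v}" by auto
    then have "negligible (K - interior K)"
      by (rule negligible_subset[rotated]) simp
    then show "K - interior K \<in> null_sets lebesgue" by (simp add: negligible_iff_null_sets)
  qed
  have interiors: "\<Union>(interior ` \<D>) \<in> sets lebesgue"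
    using D(1) by (intro sets.countable_UN') auto
  have piece: "ennreal c * emeasure lebesgue (interior K) \<le> emeasure lebesgue (interior K - N)"
    if K: "K \<in> \<D>" for K
  proof -
    obtain u v where uv: "K = {u..v}" "{u<..<v} \<noteq> {}" using D(3)[OF K] by fastforce
    then have "u < v" by auto
    then have "p \<le> u" "v \<le> q" using D(2) K uv by (auto dest!: Sup_le_iff[THEN iffD1])
    have l: "interior K - N \<in> lmeasurable"
      using uv Nl by (auto intro!: fmeasurable.Diff)
    have "ennreal c * emeasure lebesgue (interior K) = ennreal (c * (v - u))"
      using uv \<open>u < v\<close> \<open>0 < c\<close> by (simp add: ennreal_mult)
    also have "\<dots> \<le> ennreal (measure lebesgue (interior K - N))"
      using dense[OF \<open>p \<le> u\<close> \<open>u < v\<close> \<open>v \<le> q\<close>] uv by (intro ennreal_leI) simp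
    also have "\<dots> = emeasure lebesgue (interior K - N)"
      using emeasure_eq_measure2[OF l] by simp
    finally show ?thesis .
  qed
  have "emeasure lebesgue N \<le> emeasure lebesgue (\<Union>(interior ` \<D>) \<union> \<Union>((\<lambda>K. K - interior K) ` \<D>))"
    using D(7) interiors null_setsD2[OF bdry] by (intro emeasure_mono sets.Un) auto
  also have "\<dots> = emeasure lebesgue (\<Union>(interior ` \<D>))"
    by (intro emeasure_Un_null_set bdry interiors)
  also have "\<dots> = (\<integral>\<^sup>+K. emeasure lebesgue (interior K) \<partial>count_space \<D>)"
    by (intro emeasure_UN_countable D(1) disj) auto
  finally have eN_le: "emeasure lebesgue N \<le> (\<integral>\<^sup>+K. emeasure lebesgue (interior K) \<partial>count_space \<D>)" .
  have "ennreal (c * measure lebesgue N) = ennreal c * emeasure lebesgue N"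
    using eN \<open>0 < c\<close> by (simp add: ennreal_mult)
  also have "\<dots> \<le> ennreal c * (\<integral>\<^sup>+K. emeasure lebesgue (interior K) \<partial>count_space \<D>)"
    by (intro mult_left_mono eN_le) simp
  also have "\<dots> = (\<integral>\<^sup>+K. ennreal c * emeasure lebesgue (interior K) \<partial>count_space \<D>)"
    by (rule nn_integral_cmult[symmetric]) simp
  also have "\<dots> \<le> (\<integral>\<^sup>+K. emeasure lebesgue (interior K - N) \<partial>count_space \<D>)"
    by (intro nn_integral_mono piece) simp
  also have "\<dots> = emeasure lebesgue (\<Union>K\<in>\<D>. interior K - N)"
    using N by (intro emeasure_UN_countable[symmetric] D(1) disjN) auto
  also have "\<dots> \<le> emeasure lebesgue (T - N)"
  proof (rule emeasure_mono)
    show "(\<Union>K\<in>\<D>. interior K - N) \<subseteq> T - N"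
      using KT interior_subset by blast
    show "T - N \<in> sets lebesgue" using T(3) by (rule fmeasurableD)
  qed
  finally show False using T(4) by simp
qed

section \<open>The critical base of the series\<close>

lemma power_sum_finite_iff:
  "power_sum l b < \<infinity> \<longleftrightarrow> summable (\<lambda>n. b powr (- l (Suc n)))"
proof
  assume "power_sum l b < \<infinity>"
  then show "summable (\<lambda>n. b powr (- l (Suc n)))"
    unfolding power_sum_def by (intro summable_suminf_not_top) auto
next
  assume "summable (\<lambda>n. b powr (- l (Suc n)))"
  then have "power_sum l b = ennreal (\<Sum>n. b powr (- l (Suc n)))"
    unfolding power_sum_def by (intro suminf_ennreal2) auto
  then show "power_sum l b < \<infinity>" by simp
qed

lemma powr_neg_antimono: "\<lbrakk>1 < b; b \<le> b'; 0 \<le> a\<rbrakk> \<Longrightarrow> b' powr (- a) \<le> b powr (- a)" for a b b' :: real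
  by (rule powr_mono2') auto

lemma power_sum_antimono:
  assumes "\<And>n. n \<ge> 1 \<Longrightarrow> 0 \<le> l n" "1 < b" "b \<le> b'"
  shows "power_sum l b' \<le> power_sum l b"
  unfolding power_sum_def using assms
  by (intro suminf_le) (auto intro!: ennreal_leI powr_neg_antimono)

text \<open>The series decreases with the base, so the bases of divergence all lie below the bases
of convergence, and a base strictly between the supremum and the infimum would belong to neither
kind. The conventional value \<open>1\<close> for the supremum of the empty set is what makes this
argument work when the series always converges.\<close>

lemma beta_star_eq_sup:
  assumes "\<And>n. n \<ge> 1 \<Longrightarrow> 0 \<le> l n"
  shows "beta_star l = beta_star_sup l"
proof (rule antisym)
  define S where "S = {b. 1 < b \<and> power_sum l b < \<infinity>}"
  define D where "D = {b. 1 < b \<and> power_sum l b = \<infinity>}"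
  have star: "beta_star l = Inf (ereal ` S)" by (simp add: beta_star_def S_def)
  have star': "beta_star_sup l = (if D = {} then 1 else Sup (ereal ` D))"
    unfolding beta_star_sup_def D_def by (simp only: Let_def)
  have D: "ereal d \<le> beta_star_sup l" if "d \<in> D" for d
    using that by (auto simp: star' intro: Sup_upper)
  have one: "1 \<le> beta_star_sup l"
  proof (cases "D = {}")
    case False
    then obtain d where "d \<in> D" by blast
    then have "1 \<le> ereal d" by (simp add: D_def one_ereal_def)
    then show ?thesis using D[OF \<open>d \<in> D\<close>] by (rule order_trans)
  qed (simp add: star')
  show "beta_star_sup l \<le> beta_star l"
    unfolding star
  proof (rule Inf_greatest, safe)
    fix s assume s: "s \<in> S"
    have "d \<le> s" if "d \<in> D" for d
    proof (rule ccontr)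
      assume "\<not> d \<le> s"
      then have "power_sum l d \<le> power_sum l s"
        using s that assms by (intro power_sum_antimono) (auto simp: S_def D_def)
      then show False using s that by (auto simp: S_def D_def top_unique)
    qed
    then show "beta_star_sup l \<le> ereal s"
      using s by (auto simp: star' S_def one_ereal_def intro!: Sup_least)
  qed
  show "beta_star l \<le> beta_star_sup l"
  proof (rule ccontr)
    assume "\<not> beta_star l \<le> beta_star_sup l"
    then have "beta_star_sup l < beta_star l" by (simp add: not_le)
    then obtain y where y: "beta_star_sup l < ereal y" "ereal y < beta_star l"
      using ereal_dense2 by blast
    then have "1 < y" using one by (metis ereal_less(3) le_less_trans one_ereal_def less_ereal.simps(1))
    moreover have "y \<notin> S"
    proof
      assume "y \<in> S"
      then have "beta_star l \<le> ereal y" unfolding star by (intro Inf_lower) simp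
      then show False using y(2) by simp
    qed
    moreover have "y \<notin> D" using y(1) D[of y] by auto
    ultimately show False by (auto simp: S_def D_def less_top)
  qed
qed

lemma power_sum_above_beta_star:
  assumes "\<And>n. n \<ge> 1 \<Longrightarrow> 0 \<le> l n" "beta_star l < ereal b"
  shows "power_sum l b < \<infinity>"
proof -
  obtain s where s: "1 < s" "power_sum l s < \<infinity>" "s < b"
    using assms(2) by (auto simp: beta_star_def Inf_less_iff)
  then have "power_sum l b \<le> power_sum l s"
    using assms(1) by (intro power_sum_antimono) auto
  then show ?thesis using s by simp
qed

lemma power_sum_below_beta_star:
  assumes "1 < b" "ereal b < beta_star l"
  shows "power_sum l b = \<infinity>"
proof (rule ccontr)
  assume "power_sum l b \<noteq> \<infinity>"
  then have "beta_star l \<le> ereal b"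
    unfolding beta_star_def using assms by (intro Inf_lower) (auto simp: less_top)
  then show False using assms by simp
qed

section \<open>The orbit as a function of the base\<close>

definition orbit :: "real \<Rightarrow> nat \<Rightarrow> real \<Rightarrow> real" where
  "orbit x n b = (beta_T b ^^ n) x"

text \<open>These are the left end points of the branches of \<open>orbit x n\<close>: a branch
begins where one of the first \<open>n\<close> digits jumps, and from that digit on the orbit stays
at \<open>0\<close>.\<close>

definition zeros :: "real \<Rightarrow> nat \<Rightarrow> real set" where
  "zeros x n = {b. 1 < b \<and> orbit x n b = 0}"

lemma orbit_0 [simp]: "orbit x 0 b = x"
  by (simp add: orbit_def)

lemma orbit_Suc: "orbit x (Suc n) b = b * orbit x n b - of_int \<lfloor>b * orbit x n b\<rfloor>"
  by (simp add: orbit_def beta_T_def)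

lemma orbit_Suc_frac: "orbit x (Suc n) b = frac (b * orbit x n b)"
  by (simp add: orbit_Suc frac_def)

lemma orbit_Suc_bounds: "0 \<le> orbit x (Suc n) b" "orbit x (Suc n) b < 1"
  by (simp_all add: orbit_Suc_frac frac_lt_1)

lemma orbit_nonneg: "0 \<le> x \<Longrightarrow> 0 \<le> orbit x n b"
  by (cases n) (simp_all add: orbit_Suc_bounds)

lemma orbit_le_1: "x \<le> 1 \<Longrightarrow> orbit x n b \<le> 1"
  by (cases n) (simp_all add: orbit_Suc_bounds less_imp_le)

lemma orbit_less_1: "0 < n \<Longrightarrow> orbit x n b < 1"
  by (cases n) (simp_all add: orbit_Suc_bounds)

lemma orbit_Suc_eq_0_iff: "orbit x (Suc n) b = 0 \<longleftrightarrow> b * orbit x n b \<in> \<int>"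
  by (simp add: orbit_Suc_frac)

lemma zeros_Suc_iff: "b \<in> zeros x (Suc n) \<longleftrightarrow> 1 < b \<and> b * orbit x n b \<in> \<int>"
  by (simp add: zeros_def orbit_Suc_eq_0_iff)

text \<open>\<open>0\<close> is fixed by every beta-transformation.\<close>

lemma zeros_mono: "m \<le> n \<Longrightarrow> zeros x m \<subseteq> zeros x n"
proof (induction n rule: dec_induct)
  case (step n)
  then show ?case by (auto simp: zeros_def orbit_Suc)
qed simp

lemma borel_measurable_orbit [measurable]: "orbit x n \<in> borel_measurable borel"
proof (induction n)
  case 0
  have "orbit x 0 = (\<lambda>_. x)" by auto
  then show ?case by simp
next
  case (Suc n)
  have "orbit x (Suc n) = (\<lambda>b. b * orbit x n b - of_int \<lfloor>b * orbit x n b\<rfloor>)"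
    by (auto simp: orbit_Suc)
  with Suc show ?case by simp
qed

lemma shrinking_params_eq:
  "shrinking_params x xs l = {b. 1 < b \<and> (\<forall>m. \<exists>n\<ge>m. 1 \<le> n \<and> \<bar>orbit x n b - xs n\<bar> < b powr (- l n))}"
  unfolding shrinking_params_def orbit_def infinite_nat_iff_unbounded_le by simp

lemma shrinking_params_borel: "shrinking_params x xs l \<in> sets borel"
  unfolding shrinking_params_eq by measurable

locale beta_orbit =
  fixes x :: real
  assumes x: "0 < x" "x \<le> 1"
begin

abbreviation f where "f \<equiv> orbit x"
abbreviation Z where "Z \<equiv> zeros x"

lemma Z_0: "Z 0 = {}"
  using x by (auto simp: zeros_def)

lemma f_nonneg: "0 \<le> f n b" and f_le_1: "f n b \<le> 1"
  using x by (simp_all add: orbit_nonneg orbit_le_1)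

lemma f_eq_0: "b \<in> Z n \<Longrightarrow> f n b = 0"
  by (simp add: zeros_def)

text \<open>Between zeros the digits are constant, because a jump of the digit would force an
integer value of \<open>b * f n b\<close>, hence a zero, by the intermediate value theorem. The
recursion \<open>f (n + 1) b = b * f n b - digit\<close> then propagates the bounds. Both bounds are
stated in terms of the right end point \<open>t\<close>; this is the form in which the induction
closes without any loss from comparing \<open>t ^ n\<close> with \<open>s ^ n\<close>.\<close>

lemma increments:
  assumes "1 < s" "s \<le> t" "Z n \<inter> {s<..t} = {}"
  shows "0 \<le> f n t - f n s \<and> f n t - f n s \<le> (\<Sum>i<n. t ^ i) * (t - s)
    \<and> (0 < n \<longrightarrow> x * t ^ (n - 1) * (t - s) \<le> f n t - f n s)"
  using assms
proof (induction n arbitrary: s t)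
  case 0
  then show ?case by simp
next
  case (Suc n)
  have Zn: "Z n \<inter> {s<..t} = {}"
    using Suc.prems(3) zeros_mono[of n "Suc n" x] by auto
  note IH = Suc.IH[OF Suc.prems(1,2) Zn]
  let ?g = "\<lambda>b. b * f n b"
  have "0 \<le> f n b - f n a \<and> f n b - f n a \<le> (\<Sum>i<n. t ^ i) * (b - a)"
    if "s \<le> a" "a \<le> b" "b \<le> t" for a b
  proof -
    have "(\<Sum>i<n. b ^ i) * (b - a) \<le> (\<Sum>i<n. t ^ i) * (b - a)"
      using that Suc.prems by (intro mult_right_mono sum_mono power_mono) auto
    moreover have "Z n \<inter> {a<..b} = {}" using Zn that by auto
    ultimately show ?thesis
      using Suc.IH[of a b] that Suc.prems by auto
  qed
  then have "continuous_on {s..t} (f n)"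
    by (rule continuous_on_if_increments)
  then have cont: "continuous_on {s..t} ?g"
    by (intro continuous_intros)
  have incr: "?g s \<le> ?g t"
    using IH Suc.prems f_nonneg[of n s] by (intro mult_mono) auto
  have floor_eq: "\<lfloor>?g s\<rfloor> = \<lfloor>?g t\<rfloor>"
  proof (rule ccontr)
    assume ne: "\<lfloor>?g s\<rfloor> \<noteq> \<lfloor>?g t\<rfloor>"
    with incr have "\<lfloor>?g s\<rfloor> < \<lfloor>?g t\<rfloor>"
      using floor_mono[OF incr] by linarith
    then have lt: "?g s < of_int \<lfloor>?g t\<rfloor>"
      by (simp add: floor_less_iff)
    obtain c where c: "s \<le> c" "c \<le> t" "?g c = of_int \<lfloor>?g t\<rfloor>"
      using IVT'[of ?g s "of_int \<lfloor>?g t\<rfloor>" t] lt cont Suc.prems by (auto simp: less_imp_le)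
    then have "c \<noteq> s" using lt by auto
    then have "c \<in> Z (Suc n) \<inter> {s<..t}"
      unfolding Int_iff zeros_Suc_iff using c Suc.prems by simp
    then show False using Suc.prems by auto
  qed
  have eq: "f (Suc n) t - f (Suc n) s = t * (f n t - f n s) + (t - s) * f n s"
    by (simp add: orbit_Suc floor_eq algebra_simps)
  have fs: "0 \<le> (t - s) * f n s" "(t - s) * f n s \<le> (t - s) * 1"
    using Suc.prems f_nonneg f_le_1 by (intro mult_nonneg_nonneg mult_left_mono; simp)+
  have up: "t * (f n t - f n s) \<le> t * ((\<Sum>i<n. t ^ i) * (t - s))"
    using IH Suc.prems by (intro mult_left_mono) auto
  have sm: "(\<Sum>i<Suc n. t ^ i) = 1 + t * (\<Sum>i<n. t ^ i)"
    by (subst sum.lessThan_Suc_shift) (simp add: sum_distrib_left)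
  have lo: "x * t ^ n * (t - s) \<le> t * (f n t - f n s) + (t - s) * f n s"
  proof (cases n)
    case 0
    then show ?thesis by (simp add: mult.commute)
  next
    case (Suc k)
    have "t * (x * t ^ (n - 1) * (t - s)) \<le> t * (f n t - f n s)"
      using IH Suc Suc.prems by (intro mult_left_mono) auto
    then show ?thesis using fs Suc by (simp add: algebra_simps)
  qed
  show ?case
    using eq sm up fs lo incr f_nonneg[of n s] IH Suc.prems by (auto simp: algebra_simps)
qed

lemma increment_ge:
  assumes "1 < s" "s \<le> t" "Z n \<inter> {s<..t} = {}" "0 < n"
  shows "x * t ^ n / t * (t - s) \<le> f n t - f n s"
proof -
  have "x * t ^ n / t = x * t ^ (n - 1)"
    using assms by (cases n) auto
  then show ?thesis using increments[OF assms(1-3)] assms(4) by auto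
qed

lemma continuous_on_gap:
  assumes "1 < s" "Z n \<inter> {s<..t} = {}"
  shows "continuous_on {s..t} (f n)"
proof (rule continuous_on_if_increments[where K = "(\<Sum>i<n. t ^ i)"])
  fix a b assume ab: "s \<le> a" "a \<le> b" "b \<le> t"
  have "(\<Sum>i<n. b ^ i) * (b - a) \<le> (\<Sum>i<n. t ^ i) * (b - a)"
    using ab assms by (intro mult_right_mono sum_mono power_mono) auto
  moreover have "Z n \<inter> {a<..b} = {}" using assms ab by auto
  ultimately show "0 \<le> f n b - f n a \<and> f n b - f n a \<le> (\<Sum>i<n. t ^ i) * (b - a)"
    using increments[of a b n] assms ab by auto
qed

text \<open>The bounds for \<open>f (n + 1)\<close> before the digit is subtracted. They need only
that \<open>f n\<close> has no zero in the gap, and so reach up to a zero of \<open>f (n +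
1)\<close>.\<close>

lemma lift_increment:
  assumes "1 < s" "s \<le> t" "Z n \<inter> {s<..t} = {}"
  shows "t * f n t - s * f n s \<le> t ^ Suc n / (t - 1) * (t - s)"
    and "x * t ^ n * (t - s) \<le> t * f n t - s * f n s"
proof -
  have t: "1 < t" using assms by auto
  have eq: "t * f n t - s * f n s = t * (f n t - f n s) + (t - s) * f n s"
    by (simp add: algebra_simps)
  have fs: "0 \<le> (t - s) * f n s" "(t - s) * f n s \<le> (t - s) * 1"
    using assms f_nonneg f_le_1 by (intro mult_nonneg_nonneg mult_left_mono; simp)+
  have "t * (f n t - f n s) \<le> t * ((\<Sum>i<n. t ^ i) * (t - s))"
    using increments[OF assms] t by (intro mult_left_mono) auto
  moreover have "(\<Sum>i<Suc n. t ^ i) = 1 + t * (\<Sum>i<n. t ^ i)"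
    by (subst sum.lessThan_Suc_shift) (simp add: sum_distrib_left)
  ultimately have "t * f n t - s * f n s \<le> (\<Sum>i<Suc n. t ^ i) * (t - s)"
    unfolding eq using fs by (simp add: algebra_simps)
  also have "\<dots> \<le> t ^ Suc n / (t - 1) * (t - s)"
    using geometric_sum_le[OF t, of "Suc n"] assms by (intro mult_right_mono) auto
  finally show "t * f n t - s * f n s \<le> t ^ Suc n / (t - 1) * (t - s)" .
  show "x * t ^ n * (t - s) \<le> t * f n t - s * f n s"
  proof (cases n)
    case 0
    then show ?thesis by (simp add: algebra_simps)
  next
    case (Suc k)
    have "t * (x * t ^ (n - 1) * (t - s)) \<le> t * (f n t - f n s)"
      using increments[OF assms] Suc t by (intro mult_left_mono) auto
    then show ?thesis unfolding eq using fs Suc by (simp add: algebra_simps)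
  qed
qed

text \<open>At a new zero \<open>t\<close> the function \<open>b * f n b\<close> passes through an
integer, and so it does at the zero before \<open>t\<close>. Climbing from one integer to the next
takes a length given by the upper slope bound. Finiteness of \<open>Z n\<close>, which provides the
last old zero before \<open>t\<close>, is a hypothesis because it is proved together with this lemma
by induction.\<close>

lemma new_zero_separated_aux:
  assumes fin: "\<And>u v. 1 < u \<Longrightarrow> finite (Z n \<inter> {u..v})"
    and "s \<in> Z (Suc n)" "t \<in> Z (Suc n) - Z n" "s < t"
  shows "(t - 1) / t ^ Suc n \<le> t - s"
proof -
  have s1: "1 < s" and t1: "1 < t" using assms by (auto simp: zeros_def)
  have key: "(t - 1) / t ^ Suc n \<le> t - r"
    if r: "r \<in> Z (Suc n)" "s \<le> r" "r < t" "Z n \<inter> {r<..t} = {}" for r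
  proof -
    have r1: "1 < r" using r s1 by simp
    note inc = lift_increment[OF r1 less_imp_le[OF r(3)] r(4)]
    obtain i j where ij: "t * f n t = of_int i" "r * f n r = of_int j"
      using r assms by (auto simp: zeros_Suc_iff elim!: Ints_cases)
    have "0 < x * t ^ n * (t - r)" using x t1 r by simp
    then have "j < i" using inc ij by linarith
    then have "1 \<le> t * f n t - r * f n r"
      unfolding ij by linarith
    then have "1 \<le> t ^ Suc n / (t - 1) * (t - r)"
      using inc by linarith
    then show ?thesis using t1 by (simp add: field_simps)
  qed
  show ?thesis
  proof (cases "Z n \<inter> {s<..t} = {}")
    case True
    then show ?thesis using key[of s] assms by auto
  next
    case False
    let ?A = "Z n \<inter> {s<..t}"
    have "finite ?A" by (rule finite_subset[OF _ fin[OF s1, of t]]) auto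
    then have m: "Max ?A \<in> ?A" and le: "\<And>a. a \<in> ?A \<Longrightarrow> a \<le> Max ?A"
      using False Max_in[of ?A] Max_ge[of ?A] by simp_all
    have gap: "Z n \<inter> {Max ?A<..t} = {}"
      using m le by fastforce
    have "Max ?A < t" using m assms by (metis DiffE IntE greaterThanAtMost_iff order_le_less)
    then show ?thesis
      using key[of "Max ?A"] m gap zeros_mono[of n "Suc n" x] by auto
  qed
qed

lemma finite_Z: "1 < u \<Longrightarrow> finite (Z n \<inter> {u..v})"
proof (induction n arbitrary: u v)
  case 0
  then show ?case by (simp add: Z_0)
next
  case (Suc n)
  let ?N = "(Z (Suc n) - Z n) \<inter> {u..v}"
  have "finite ?N"
  proof (rule finite_if_separated)
    show "?N \<subseteq> {u..max u v}" by auto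
    show "0 < (u - 1) / max u v ^ Suc n" using Suc.prems by (auto simp: less_max_iff_disj)
    fix s t assume st: "s \<in> ?N" "t \<in> ?N" "s < t"
    then have "(t - 1) / t ^ Suc n \<le> t - s"
      using new_zero_separated_aux[of n s t] Suc.IH by auto
    moreover have "(u - 1) / max u v ^ Suc n \<le> (t - 1) / t ^ Suc n"
      using st Suc.prems by (intro scale_antimono) auto
    ultimately show "(u - 1) / max u v ^ Suc n \<le> t - s" by simp
  qed
  then have "finite (Z n \<inter> {u..v} \<union> ?N)" using Suc by simp
  then show ?case by (rule finite_subset[rotated]) auto
qed

lemma finite_Z_open: "1 < u \<Longrightarrow> finite (Z n \<inter> {u<..<v})"
  by (rule finite_subset[OF _ finite_Z[of u n v]]) auto

lemma new_zero_separated: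
  assumes "s \<in> Z (Suc n)" "t \<in> Z (Suc n) - Z n" "s < t"
  shows "(t - 1) / t ^ Suc n \<le> t - s"
  using new_zero_separated_aux[OF finite_Z] assms by blast

text \<open>A branch cannot climb higher than \<open>1\<close>.\<close>

lemma gap_length_le:
  assumes "1 < s" "s \<le> b" "b \<le> q" "Z n \<inter> {s<..b} = {}" "0 < n"
  shows "b - s \<le> q / (x * b ^ n)"
proof -
  have "x * b ^ n / b * (b - s) \<le> f n b - f n s"
    using increment_ge assms by auto
  also have "\<dots> \<le> 1" using f_le_1[of n b] f_nonneg[of n s] by linarith
  finally have "b - s \<le> b / (x * b ^ n)"
    using assms x by (simp add: field_simps)
  also have "\<dots> \<le> q / (x * b ^ n)"
    using assms x by (intro divide_right_mono) auto
  finally show ?thesis .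
qed

lemma lift_continuous_on_gap:
  assumes "1 < s" "Z n \<inter> {s<..t} = {}"
  shows "continuous_on {s..t} (\<lambda>b. b * f n b)"
  using continuous_on_gap[OF assms] by (intro continuous_intros)

lemma lift_strict_mono_on_gap:
  assumes "1 < s" "s < t" "Z n \<inter> {s<..t} = {}"
  shows "s * f n s < t * f n t"
proof -
  have "0 < x * t ^ n * (t - s)" using assms x by simp
  then show ?thesis using lift_increment(2)[of s t n] assms by simp
qed

section \<open>Counting branches\<close>

text \<open>The left end point \<open>u\<close> is counted like a zero because the branch in
progress at \<open>u\<close> also meets the interval.\<close>

definition cell_weight :: "nat \<Rightarrow> real \<Rightarrow> real \<Rightarrow> real" where
  "cell_weight n u v = (\<Sum>s\<in>insert u (Z n \<inter> {u<..<v}). 1 / s ^ n)"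

lemma cell_weight_eq: "1 < u \<Longrightarrow> cell_weight n u v = 1 / u ^ n + (\<Sum>s\<in>Z n \<inter> {u<..<v}. 1 / s ^ n)"
  unfolding cell_weight_def by (subst sum.insert) (auto simp: finite_Z_open)

lemma new_zeros_sum_le:
  assumes "1 < u" "u \<le> v"
  shows "(\<Sum>s\<in>(Z (Suc n) - Z n) \<inter> {u<..<v}. 1 / s ^ Suc n) \<le> (v - u) / (u - 1) + 1 / u ^ Suc n"
proof (rule sum_separated_le)
  show "finite ((Z (Suc n) - Z n) \<inter> {u<..<v})"
    by (rule finite_subset[OF _ finite_Z_open[OF assms(1), of "Suc n" v]]) auto
  fix a assume "a \<in> (Z (Suc n) - Z n) \<inter> {u<..<v}"
  then show "1 / a ^ Suc n \<le> 1 / u ^ Suc n"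
    using assms by (intro frac_le power_mono) auto
next
  fix s t assume st: "s \<in> (Z (Suc n) - Z n) \<inter> {u<..<v}" "t \<in> (Z (Suc n) - Z n) \<inter> {u<..<v}" "s < t"
  have "(u - 1) * (1 / t ^ Suc n) \<le> (t - 1) / t ^ Suc n"
    using st assms by (simp add: divide_right_mono)
  also have "\<dots> \<le> t - s"
    using st by (intro new_zero_separated) auto
  finally show "(u - 1) * (1 / t ^ Suc n) \<le> t - s" .
qed (use assms in auto)

text \<open>Old zeros lose a factor \<open>u\<close>, and new ones are separated.\<close>

lemma cell_weight_Suc_le:
  assumes "1 < u" "u \<le> v"
  shows "cell_weight (Suc n) u v \<le> cell_weight n u v / u + (v - u) / (u - 1) + 1 / u ^ Suc n"
proof -
  let ?I = "{u<..<v}"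
  have split: "Z (Suc n) \<inter> ?I = (Z n \<inter> ?I) \<union> ((Z (Suc n) - Z n) \<inter> ?I)"
    using zeros_mono[of n "Suc n" x] by auto
  have fin: "finite (Z n \<inter> ?I)" "finite ((Z (Suc n) - Z n) \<inter> ?I)"
    using finite_Z_open[OF assms(1)] by (auto intro: finite_subset[OF _ finite_Z_open[OF assms(1), of "Suc n" v]])
  have "(\<Sum>s\<in>Z n \<inter> ?I. 1 / s ^ Suc n) \<le> (\<Sum>s\<in>Z n \<inter> ?I. 1 / s ^ n / u)"
  proof (rule sum_mono)
    fix s assume "s \<in> Z n \<inter> ?I"
    then have "u < s" by auto
    then show "1 / s ^ Suc n \<le> 1 / s ^ n / u"
      using assms by (simp add: field_simps)
  qed
  then have old: "(\<Sum>s\<in>Z n \<inter> ?I. 1 / s ^ Suc n) \<le> (\<Sum>s\<in>Z n \<inter> ?I. 1 / s ^ n) / u"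
    by (simp add: sum_divide_distrib)
  have "cell_weight (Suc n) u v = 1 / u ^ Suc n + (\<Sum>s\<in>Z n \<inter> ?I. 1 / s ^ Suc n)
      + (\<Sum>s\<in>(Z (Suc n) - Z n) \<inter> ?I. 1 / s ^ Suc n)"
    unfolding cell_weight_eq[OF assms(1)] split using fin by (subst sum.union_disjoint) auto
  also have "\<dots> \<le> 1 / u ^ n / u + (\<Sum>s\<in>Z n \<inter> ?I. 1 / s ^ n) / u + ((v - u) / (u - 1) + 1 / u ^ Suc n)"
    using old new_zeros_sum_le[OF assms, of n] assms by (intro add_mono) (auto simp: field_simps)
  finally show ?thesis
    unfolding cell_weight_eq[OF assms(1)] by (simp add: add_divide_distrib)
qed

text \<open>Iteration of \<open>cell_weight_Suc_le\<close> from a level \<open>m\<close> at which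
the interval lies in a single branch. The constant \<open>p / (p - 1)\<^sup>2\<close> is the fixed
point of \<open>C \<mapsto> C / p + 1 / (p - 1)\<close>; the boundary term decays up to a polynomial
factor.\<close>

lemma cell_weight_le:
  assumes "1 < p" "p \<le> u" "u \<le> v" "Z m \<inter> {u<..<v} = {}"
  shows "cell_weight (m + k) u v \<le> p / (p - 1)^2 * (v - u) + (real k + 1) / (p ^ k * u ^ m)"
proof (induction k)
  case 0
  have "cell_weight m u v = 1 / u ^ m" using assms by (simp add: cell_weight_def)
  moreover have "0 \<le> p / (p - 1)^2 * (v - u)" using assms by simp
  ultimately show ?case by simp
next
  case (Suc k)
  let ?C = "p / (p - 1)^2"
  have u: "1 < u" using assms by simp
  have nn: "0 \<le> ?C * (v - u) + (real k + 1) / (p ^ k * u ^ m)" using assms by simp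
  have "cell_weight (m + Suc k) u v \<le> cell_weight (m + k) u v / u + (v - u) / (u - 1) + 1 / u ^ Suc (m + k)"
    using cell_weight_Suc_le[OF u assms(3)] by simp
  also have "\<dots> \<le> (?C * (v - u) + (real k + 1) / (p ^ k * u ^ m)) / p + (v - u) / (p - 1) + 1 / (p ^ Suc k * u ^ m)"
  proof (intro add_mono)
    have "cell_weight (m + k) u v / u \<le> (?C * (v - u) + (real k + 1) / (p ^ k * u ^ m)) / u"
      by (rule divide_right_mono[OF Suc.IH]) (use u in simp)
    also have "\<dots> \<le> (?C * (v - u) + (real k + 1) / (p ^ k * u ^ m)) / p"
      using assms nn by (intro divide_left_mono) auto
    finally show "cell_weight (m + k) u v / u \<le> \<dots>" .
    show "(v - u) / (u - 1) \<le> (v - u) / (p - 1)"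
      using assms by (intro divide_left_mono) auto
    have "p ^ Suc k * u ^ m \<le> u ^ Suc k * u ^ m"
      using assms by (intro mult_right_mono power_mono) auto
    then show "1 / u ^ Suc (m + k) \<le> 1 / (p ^ Suc k * u ^ m)"
      using assms by (intro frac_le) (auto simp: power_add mult_ac)
  qed
  also have "\<dots> = (?C / p + 1 / (p - 1)) * (v - u) + ((real k + 1) / (p ^ k * u ^ m) / p + 1 / (p ^ Suc k * u ^ m))"
    by (simp add: add_divide_distrib distrib_right)
  also have "?C / p + 1 / (p - 1) = ?C"
  proof -
    have "?C / p = 1 / (p - 1)^2" using assms by simp
    moreover have "1 / (p - 1) = (p - 1) / (p - 1)^2"
      using assms by (simp add: power2_eq_square)
    ultimately show ?thesis by (simp add: add_divide_distrib[symmetric])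
  qed
  also have "(real k + 1) / (p ^ k * u ^ m) / p + 1 / (p ^ Suc k * u ^ m) = (real (Suc k) + 1) / (p ^ Suc k * u ^ m)"
    using assms by (simp add: add_divide_distrib mult_ac)
  finally show ?case .
qed

text \<open>There are no zeros at level \<open>0\<close>, so \<open>cell_weight_le\<close> applies
with \<open>m = 0\<close> to every interval.\<close>

lemma eventually_cell_weight_le:
  assumes "1 < p" "p \<le> u" "u < v"
  shows "eventually (\<lambda>n. cell_weight n u v \<le> 2 * (p / (p - 1)^2) * (v - u)) sequentially"
proof -
  let ?C = "p / (p - 1)^2"
  have "0 < ?C * (v - u)" using assms by simp
  then have "eventually (\<lambda>n. (real n + 1) / p ^ n < ?C * (v - u)) sequentially"
    using arith_geometric_tendsto_0(1)[OF assms(1)] order_tendstoD(2) by blast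
  then show ?thesis
  proof eventually_elim
    case (elim n)
    have "cell_weight (0 + n) u v \<le> ?C * (v - u) + (real n + 1) / (p ^ n * u ^ 0)"
      by (rule cell_weight_le) (use assms Z_0 in auto)
    then show ?case using elim by simp
  qed
qed

section \<open>Upper bounds for hitting a target\<close>

definition hits :: "nat \<Rightarrow> real \<Rightarrow> real \<Rightarrow> real \<Rightarrow> real \<Rightarrow> real set" where
  "hits n z r u v = {b \<in> {u<..<v}. \<bar>f n b - z\<bar> < r}"

lemma hits_measurable [measurable, simp]: "hits n z r u v \<in> sets borel"
  unfolding hits_def by measurable

lemma hits_lmeasurable [simp]: "hits n z r u v \<in> lmeasurable"
proof (rule fmeasurableI2)
  show "{u..v} \<in> lmeasurable" by simp
  show "hits n z r u v \<subseteq> {u..v}" by (auto simp: hits_def)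
qed simp

lemma last_zero_before:
  assumes "1 < u" "u \<le> b"
  obtains s where "s \<in> insert u (Z n \<inter> {u<..b})" "Z n \<inter> {s<..b} = {}"
proof -
  let ?A = "insert u (Z n \<inter> {u<..b})"
  have fin: "finite ?A"
    by (simp, rule finite_subset[OF _ finite_Z[OF assms(1), of n b]]) auto
  have "Max ?A \<in> ?A" using fin by (intro Max_in) auto
  moreover have "Z n \<inter> {Max ?A<..b} = {}"
  proof -
    have "a \<le> Max ?A" if "a \<in> ?A" for a using fin that by (rule Max_ge)
    moreover have "u \<le> Max ?A" using fin by simp
    ultimately show ?thesis by fastforce
  qed
  ultimately show thesis by (rule that)
qed

text \<open>One interval for each branch that meets \<open>(u,v)\<close>, short because \<open>f
n\<close> climbs fast. That the open intervals contain no zero is what allows a later target to be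
studied inside each of them.\<close>

lemma hits_cover:
  assumes "1 < u" "u < v" "v \<le> q" "0 < n" "0 \<le> r"
  obtains a b where
    "\<And>s. s \<in> insert u (Z n \<inter> {u<..<v}) \<Longrightarrow> s \<le> a s \<and> a s \<le> b s \<and> b s \<le> v \<and>
      Z n \<inter> {a s<..<b s} = {} \<and> b s - a s \<le> 2 * r * q / x * (1 / s ^ n)"
    "hits n z r u v \<subseteq> (\<Union>s\<in>insert u (Z n \<inter> {u<..<v}). {a s..b s})"
proof -
  \<comment> \<open>The part of the target set in the branch that starts at \<open>s\<close>.\<close>
  define P where "P s = {b \<in> hits n z r u v. s \<le> b \<and> Z n \<inter> {s<..b} = {}}" for s
  define a where "a s = (if P s = {} then s else Inf (P s))" for s
  define b where "b s = (if P s = {} then s else Sup (P s))" for s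
  have Psub: "P s \<subseteq> {s..v}" "P s \<subseteq> {u<..<v}" for s
    by (auto simp: P_def hits_def)
  have bdd: "bdd_above (P s)" "bdd_below (P s)" for s
    by (rule bdd_above_mono[OF bdd_above_Icc Psub(1)], rule bdd_below_mono[OF bdd_below_Icc Psub(1)])
  have len: "c' - c \<le> 2 * r * q / x * (1 / s ^ n)"
    if "c \<in> P s" "c' \<in> P s" "u \<le> s" for c c' s
  proof (cases "c < c'")
    case False
    have "0 \<le> 2 * r * q / x * (1 / s ^ n)" using assms x that by auto
    with False show ?thesis by linarith
  next
    case True
    have c: "1 < c" "s \<le> c" "c' < q" using Psub that assms by fastforce+
    have c': "1 < c'" "s \<le> c'" using c True by auto
    have gap: "Z n \<inter> {c<..c'} = {}"
      using that c by (auto simp: P_def)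
    have "x * c' ^ n / c' * (c' - c) \<le> f n c' - f n c"
      using increment_ge[OF _ _ gap] c True assms by auto
    also have "\<dots> \<le> 2 * r" using that by (auto simp: P_def hits_def)
    finally have "c' - c \<le> 2 * r * c' / (x * c' ^ n)"
      using c' x by (simp add: field_simps)
    also have "\<dots> \<le> 2 * r * q / (x * s ^ n)"
      using c c' x assms that by (intro frac_le mult_left_mono power_mono mult_mono) auto
    finally show ?thesis by simp
  qed
  show thesis
  proof (rule that[of a b])
    fix s assume s: "s \<in> insert u (Z n \<inter> {u<..<v})"
    then have us: "u \<le> s" "s \<le> v" using assms by auto
    show "s \<le> a s \<and> a s \<le> b s \<and> b s \<le> v \<and> Z n \<inter> {a s<..<b s} = {}
      \<and> b s - a s \<le> 2 * r * q / x * (1 / s ^ n)"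
    proof (cases "P s = {}")
      case True
      then show ?thesis using us assms x by (auto simp: a_def b_def)
    next
      case False
      have "s \<le> Inf (P s)" using False Psub(1)[of s] by (intro cInf_greatest) auto
      moreover have "Sup (P s) \<le> v" using False Psub(1)[of s] by (intro cSup_least) auto
      moreover have "Inf (P s) \<le> Sup (P s)" using False bdd by (intro cInf_le_cSup)
      moreover have "Z n \<inter> {Inf (P s)<..<Sup (P s)} = {}"
      proof -
        have "y \<notin> Z n" if y: "Inf (P s) < y" "y < Sup (P s)" for y
        proof -
          obtain c where "c \<in> P s" "y < c" using y(2) False bdd by (auto simp: less_cSup_iff)
          moreover have "s < y" using y(1) \<open>s \<le> Inf (P s)\<close> by simp
          ultimately show ?thesis by (auto simp: P_def)
        qed
        then show ?thesis by auto
      qed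
      moreover have "Sup (P s) - Inf (P s) \<le> 2 * r * q / x * (1 / s ^ n)" (is "_ \<le> ?L")
      proof -
        have "c' - ?L \<le> Inf (P s)" if "c' \<in> P s" for c'
          using False len[OF _ that us(1)] by (intro cInf_greatest) (auto simp: algebra_simps)
        then have "Sup (P s) \<le> Inf (P s) + ?L"
          using False by (intro cSup_least) (auto simp: algebra_simps)
        then show ?thesis by simp
      qed
      ultimately show ?thesis using False by (simp add: a_def b_def)
    qed
  next
    show "hits n z r u v \<subseteq> (\<Union>s\<in>insert u (Z n \<inter> {u<..<v}). {a s..b s})"
    proof
      fix c assume c: "c \<in> hits n z r u v"
      then have uc: "u < c" "c < v" by (auto simp: hits_def)
      obtain s where s: "s \<in> insert u (Z n \<inter> {u<..c})" "Z n \<inter> {s<..c} = {}"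
        using last_zero_before[of u c n] uc assms by auto
      then have "c \<in> P s" using c uc by (auto simp: P_def)
      then have "c \<in> {a s..b s}"
        using bdd by (auto simp: a_def b_def intro: cInf_lower cSup_upper)
      moreover have "s \<in> insert u (Z n \<inter> {u<..<v})" using s uc by auto
      ultimately show "c \<in> (\<Union>s\<in>insert u (Z n \<inter> {u<..<v}). {a s..b s})" by blast
    qed
  qed
qed

lemma measure_hits_le:
  assumes "1 < u" "u \<le> v" "v \<le> q" "0 < n" "0 \<le> r"
  shows "measure lebesgue (hits n z r u v) \<le> 2 * r * q / x * cell_weight n u v"
proof (cases "u = v")
  case True
  then show ?thesis using assms x by (simp add: hits_def cell_weight_def)
next
  case False
  let ?S = "insert u (Z n \<inter> {u<..<v})"
  have "u < v" using False assms by simp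
  obtain a b where
    ab: "\<And>s. s \<in> ?S \<Longrightarrow> s \<le> a s \<and> a s \<le> b s \<and> b s \<le> v \<and>
      Z n \<inter> {a s<..<b s} = {} \<and> b s - a s \<le> 2 * r * q / x * (1 / s ^ n)"
    and cover: "hits n z r u v \<subseteq> (\<Union>s\<in>?S. {a s..b s})"
    using hits_cover[OF assms(1) \<open>u < v\<close> assms(3-5), of z] by blast
  have fin: "finite ?S" using finite_Z_open[OF assms(1)] by simp
  have "measure lebesgue (hits n z r u v) \<le> measure lebesgue (\<Union>s\<in>?S. {a s..b s})"
    using cover fin by (intro measure_mono_fmeasurable fmeasurable.finite_UN) auto
  also have "\<dots> \<le> (\<Sum>s\<in>?S. measure lebesgue {a s..b s})"
    using fin by (intro measure_UNION_le) auto
  also have "\<dots> \<le> (\<Sum>s\<in>?S. 2 * r * q / x * (1 / s ^ n))"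
    using ab by (intro sum_mono) auto
  also have "\<dots> = 2 * r * q / x * cell_weight n u v"
    unfolding cell_weight_def by (rule sum_distrib_left[symmetric])
  finally show ?thesis .
qed

text \<open>Inside a piece that hits the target at time \<open>m\<close> there is a single branch of
level \<open>m\<close>, so \<open>cell_weight_le\<close> bounds the hits at time \<open>m +
k\<close> by the length of the piece, of order \<open>r / s ^ m\<close>, plus a boundary term with a
factor \<open>(k + 1) / p ^ k\<close>.\<close>

lemma measure_hits_Int_le:
  assumes "1 < p" "p \<le> u" "u < v" "v \<le> q" "0 < m" "0 \<le> r" "0 \<le> r'"
  shows "measure lebesgue (hits m z r u v \<inter> hits (m + k) z' r' u v)
    \<le> 2 * r' * q / x * (p / (p - 1)^2 * (2 * r * q / x) + (real k + 1) / p ^ k) * cell_weight m u v"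
proof -
  let ?S = "insert u (Z m \<inter> {u<..<v})"
  let ?C = "p / (p - 1)^2"
  have u1: "1 < u" using assms by simp
  obtain a b where
    ab: "\<And>s. s \<in> ?S \<Longrightarrow> s \<le> a s \<and> a s \<le> b s \<and> b s \<le> v \<and>
      Z m \<inter> {a s<..<b s} = {} \<and> b s - a s \<le> 2 * r * q / x * (1 / s ^ m)"
    and cover: "hits m z r u v \<subseteq> (\<Union>s\<in>?S. {a s..b s})"
    using hits_cover[OF u1 assms(3-6), of z] by blast
  \<comment> \<open>The end points have to be added because \<open>hits\<close> refers to open intervals.\<close>
  let ?H = "\<lambda>s. {a s, b s} \<union> hits (m + k) z' r' (a s) (b s)"
  have fin: "finite ?S" using finite_Z_open[OF u1] by simp
  have Hm: "?H s \<in> lmeasurable" for s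
    by (rule fmeasurable.Un[OF lmeasurable_compact[OF finite_imp_compact]]) simp_all
  have cov: "hits m z r u v \<inter> hits (m + k) z' r' u v \<subseteq> (\<Union>s\<in>?S. ?H s)"
  proof
    fix c assume c: "c \<in> hits m z r u v \<inter> hits (m + k) z' r' u v"
    then obtain s where s: "s \<in> ?S" "c \<in> {a s..b s}" using cover by blast
    then have "c \<in> ?H s" using c by (auto simp: hits_def)
    then show "c \<in> (\<Union>s\<in>?S. ?H s)" using s by blast
  qed
  have one: "measure lebesgue (?H s)
      \<le> 2 * r' * q / x * (?C * (2 * r * q / x) + (real k + 1) / p ^ k) * (1 / s ^ m)"
    if s: "s \<in> ?S" for s
  proof -
    have us: "u \<le> s" "u \<le> a s" using s ab[OF s] by auto
    have "cell_weight (m + k) (a s) (b s) \<le> ?C * (b s - a s) + (real k + 1) / (p ^ k * a s ^ m)"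
      using ab[OF s] us assms by (intro cell_weight_le) auto
    also have "\<dots> \<le> ?C * (2 * r * q / x * (1 / s ^ m)) + (real k + 1) / (p ^ k * s ^ m)"
    proof (rule add_mono)
      show "?C * (b s - a s) \<le> ?C * (2 * r * q / x * (1 / s ^ m))"
        using ab[OF s] assms by (intro mult_left_mono) auto
      show "(real k + 1) / (p ^ k * a s ^ m) \<le> (real k + 1) / (p ^ k * s ^ m)"
        using ab[OF s] us assms by (intro divide_left_mono mult_left_mono power_mono) auto
    qed
    finally have Wle: "cell_weight (m + k) (a s) (b s)
      \<le> ?C * (2 * r * q / x * (1 / s ^ m)) + (real k + 1) / (p ^ k * s ^ m)" .
    have "measure lebesgue {a s, b s} = 0"
      by (intro negligible_imp_measure0 negligible_finite) simp
    moreover have "measure lebesgue (?H s)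
        \<le> measure lebesgue {a s, b s} + measure lebesgue (hits (m + k) z' r' (a s) (b s))"
      by (intro measure_Un_le) auto
    ultimately have "measure lebesgue (?H s) \<le> measure lebesgue (hits (m + k) z' r' (a s) (b s))"
      by linarith
    also have "\<dots> \<le> 2 * r' * q / x * cell_weight (m + k) (a s) (b s)"
      using ab[OF s] us u1 assms by (intro measure_hits_le) auto
    also have "\<dots> \<le> 2 * r' * q / x * (?C * (2 * r * q / x * (1 / s ^ m)) + (real k + 1) / (p ^ k * s ^ m))"
      using assms x by (intro mult_left_mono[OF Wle]) auto
    also have "\<dots> = 2 * r' * q / x * (?C * (2 * r * q / x) + (real k + 1) / p ^ k) * (1 / s ^ m)"
    proof -
      have "(real k + 1) / (p ^ k * s ^ m) = (real k + 1) / p ^ k * (1 / s ^ m)" by simp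
      then show ?thesis by (simp only: distrib_right mult.assoc)
    qed
    finally show ?thesis .
  qed
  have "measure lebesgue (hits m z r u v \<inter> hits (m + k) z' r' u v) \<le> measure lebesgue (\<Union>s\<in>?S. ?H s)"
    using cov fin Hm by (intro measure_mono_fmeasurable fmeasurable.finite_UN) auto
  also have "\<dots> \<le> (\<Sum>s\<in>?S. measure lebesgue (?H s))"
    using fin Hm by (intro measure_UNION_le) auto
  also have "\<dots> \<le> (\<Sum>s\<in>?S. 2 * r' * q / x * (?C * (2 * r * q / x) + (real k + 1) / p ^ k) * (1 / s ^ m))"
    using one by (rule sum_mono)
  also have "\<dots> = 2 * r' * q / x * (?C * (2 * r * q / x) + (real k + 1) / p ^ k) * cell_weight m u v"
    unfolding cell_weight_def by (rule sum_distrib_left[symmetric])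
  finally show ?thesis .
qed

section \<open>Branches onto the whole unit interval\<close>

text \<open>Each step multiplies the height of the first piece of the branch at \<open>s\<close> by
at least \<open>p\<close> until it reaches \<open>1\<close>. From then on the piece between
\<open>s\<close> and the first zero after it covers the unit interval, and so produces another new
zero at each further step; this yields one at exactly the prescribed time.\<close>

lemma new_zero_exists:
  assumes "1 < p" "p \<le> s"
  shows "\<lbrakk>s \<in> Z n; s < y; Z n \<inter> {s<..y} = {}; 1 \<le> p ^ k * f n y\<rbrakk>
    \<Longrightarrow> \<exists>t. t \<in> Z (n + k) - Z (n + k - 1) \<and> s < t \<and> t \<le> y"
proof (induction k arbitrary: n y)
  case 0
  then have "0 < n" using Z_0 by (cases n) auto
  then show ?case using 0 orbit_less_1[of n x y] by simp
next
  case (Suc k)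
  have s1: "1 < s" using assms by simp
  have fs: "f n s = 0" using Suc.prems by (simp add: f_eq_0)
  have sZ: "s \<in> Z (Suc n)" using Suc.prems zeros_mono[of n "Suc n" x] by auto
  have floor0: "f (Suc n) c = c * f n c" if "1 < c" "c * f n c < 1" for c
  proof -
    have "0 \<le> c * f n c" using that f_nonneg[of n c] by simp
    then have "\<lfloor>c * f n c\<rfloor> = 0" using that by (simp add: floor_eq_iff)
    then show ?thesis by (simp add: orbit_Suc)
  qed
  show ?case
  proof (cases "Z (Suc n) \<inter> {s<..y} = {}")
    case True
    have "y * f n y < 1"
    proof (rule ccontr)
      assume "\<not> y * f n y < 1"
      then obtain c where c: "s \<le> c" "c \<le> y" "c * f n c = 1"
        using IVT'[of "\<lambda>b. b * f n b" s 1 y] lift_continuous_on_gap[OF s1 Suc.prems(3)] fs Suc.prems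
        by auto
      then have "c \<noteq> s" using fs by auto
      then have "c \<in> Z (Suc n) \<inter> {s<..y}"
        unfolding Int_iff zeros_Suc_iff using c s1 by simp
      then show False using True by simp
    qed
    then have "f (Suc n) y = y * f n y"
      using floor0 Suc.prems s1 by auto
    moreover have "p * f n y \<le> y * f n y"
      using assms Suc.prems f_nonneg[of n y] by (intro mult_right_mono) auto
    ultimately have "p ^ k * (p * f n y) \<le> p ^ k * f (Suc n) y"
      using assms by (intro mult_left_mono) auto
    then have "1 \<le> p ^ k * f (Suc n) y"
      using Suc.prems(4) by (simp add: mult_ac)
    then show ?thesis using Suc.IH[of "Suc n" y] True sZ Suc.prems by auto
  next
    case False
    define t where "t = Min (Z (Suc n) \<inter> {s<..y})"
    have fin: "finite (Z (Suc n) \<inter> {s<..y})"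
      by (rule finite_subset[OF _ finite_Z[OF s1, of "Suc n" y]]) auto
    have t: "t \<in> Z (Suc n)" "s < t" "t \<le> y"
      using Min_in[OF fin False] by (auto simp: t_def)
    have least: "t \<le> c" if "c \<in> Z (Suc n)" "s < c" "c \<le> y" for c
      using fin that by (auto simp: t_def intro: Min_le)
    have gap: "Z n \<inter> {s<..t} = {}" using Suc.prems t by auto
    show ?thesis
    proof (cases "k = 0")
      case True
      then show ?thesis using t gap by auto
    next
      case False
      obtain i where i: "t * f n t = of_int i"
        using t by (auto simp: zeros_Suc_iff elim!: Ints_cases)
      then have "1 \<le> t * f n t"
        using lift_strict_mono_on_gap[OF s1 t(2) gap] fs by simp
      \<comment> \<open>Stopping at height \<open>1 / p\<close> leaves the induction hypothesis applicable with \<open>k\<close> steps to go.\<close>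
      moreover have "1 / p < 1" "0 < 1 / p" using assms by auto
      ultimately obtain c where c: "s \<le> c" "c \<le> t" "c * f n c = 1 / p"
        using IVT'[of "\<lambda>b. b * f n b" s "1 / p" t] lift_continuous_on_gap[OF s1 gap] fs t
        by fastforce
      have "c \<noteq> s" "c \<noteq> t"
        using c fs \<open>1 \<le> t * f n t\<close> \<open>1 / p < 1\<close> \<open>0 < 1 / p\<close> by auto
      then have "s < c" "c < t" using c by auto
      have "f (Suc n) c = 1 / p"
        using floor0[of c] c s1 \<open>1 / p < 1\<close> by auto
      moreover have "p ^ 1 \<le> p ^ k" using False assms by (intro power_increasing) auto
      ultimately have "1 \<le> p ^ k * f (Suc n) c" using assms by simp
      moreover have "Z (Suc n) \<inter> {s<..c} = {}"
        using least \<open>c < t\<close> t by fastforce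
      ultimately obtain t' where "t' \<in> Z (Suc n + k) - Z (Suc n + k - 1)" "s < t'" "t' \<le> c"
        using Suc.IH[of "Suc n" c] sZ \<open>s < c\<close> by auto
      then show ?thesis using \<open>c < t\<close> t by auto
    qed
  qed
qed

text \<open>To the left of a new zero the orbit function rises to \<open>1\<close>, so new zeros
mark the branches onto the whole unit interval.\<close>

definition new_zeros :: "nat \<Rightarrow> real set" where
  "new_zeros n = Z n - Z (n - 1)"

lemma finite_new_zeros: "1 < u \<Longrightarrow> finite (new_zeros n \<inter> {u<..<v})"
  by (rule finite_subset[OF _ finite_Z_open[of u n v]]) (auto simp: new_zeros_def)

text \<open>Bases with \<open>f n b < \<delta>\<close> fill at most a quarter of the interval. Any
other base \<open>b\<close> beyond the first zero lies, by \<open>new_zero_exists\<close>, shortly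
after a new zero of level \<open>n + k\<close>, where \<open>k\<close> depends only on
\<open>\<delta>\<close>. The short intervals after these new zeros therefore cover half of the
interval.\<close>

lemma eventually_new_zeros_sum_ge:
  assumes "1 < p" "p < q"
  obtains c where "0 < c" "\<And>u v. \<lbrakk>p \<le> u; u < v; v \<le> q\<rbrakk> \<Longrightarrow>
     eventually (\<lambda>n. c * (v - u) \<le> (\<Sum>t\<in>new_zeros n \<inter> {u<..<v}. 1 / t ^ n)) sequentially"
proof -
  define C where "C = p / (p - 1)^2"
  \<comment> \<open>With this \<open>\<delta>\<close> the bases with \<open>f n b < \<delta>\<close> have measure at most \<open>(v - u) / 4\<close>.\<close>
  define \<delta> where "\<delta> = x / (16 * q * C)"
  have C: "0 < C" using assms by (simp add: C_def)
  have \<delta>: "0 < \<delta>" using C x assms by (simp add: \<delta>_def)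
  obtain k where "1 / \<delta> < p ^ k" using real_arch_pow assms by blast
  then have k: "1 \<le> p ^ k * \<delta>" using \<delta> by (simp add: field_simps)
  define D where "D = q ^ Suc k / x"
  have D: "0 < D" using x assms by (simp add: D_def)
  show thesis
  proof (rule that[of "1 / (2 * D)"])
    show "0 < 1 / (2 * D)" using D by simp
    fix u v assume uv: "p \<le> u" "u < v" "v \<le> q"
    have u1: "1 < u" using uv assms by simp
    have "0 < (v - u) / 4" using uv by simp
    then have "eventually (\<lambda>n. (q / x) / p ^ n < (v - u) / 4) sequentially"
      using arith_geometric_tendsto_0(2)[OF assms(1)] order_tendstoD(2) by blast
    then have "eventually (\<lambda>n. 1 / (2 * D) * (v - u)
       \<le> (\<Sum>t\<in>new_zeros (n + k) \<inter> {u<..<v}. 1 / t ^ (n + k))) sequentially"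
      using eventually_cell_weight_le[OF assms(1) uv(1,2)] eventually_gt_at_top[of 0]
    proof eventually_elim
      case (elim n)
      let ?N = "new_zeros (n + k) \<inter> {u<..<v}"
      let ?I = "{u..u + q / x / p ^ n}"
      let ?J = "\<lambda>t. {t..t + D * (1 / t ^ (n + k))}"
      have fin: "finite ?N" by (rule finite_new_zeros[OF u1])
      have cover: "{u<..<v} \<subseteq> (hits n 0 \<delta> u v \<union> ?I) \<union> (\<Union>t\<in>?N. ?J t)"
      proof
        fix b assume b: "b \<in> {u<..<v}"
        obtain s where s: "s \<in> insert u (Z n \<inter> {u<..b})" "Z n \<inter> {s<..b} = {}"
          using last_zero_before[of u b n] b u1 by auto
        have len: "b - s \<le> q / (x * b ^ n)"
          using s b u1 uv elim by (intro gap_length_le) auto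
        \<comment> \<open>In the second case \<open>b\<close> precedes all zeros in \<open>(u,v)\<close>, and so it is close to \<open>u\<close>.\<close>
        consider "b \<in> hits n 0 \<delta> u v" | "\<delta> \<le> f n b" "s = u" | "\<delta> \<le> f n b" "s \<in> Z n \<inter> {u<..b}"
          using s b f_nonneg[of n b] by (cases "\<delta> \<le> f n b") (auto simp: hits_def)
        then show "b \<in> (hits n 0 \<delta> u v \<union> ?I) \<union> (\<Union>t\<in>?N. ?J t)"
        proof cases
          case 2
          have "q / (x * b ^ n) \<le> q / (x * p ^ n)"
            using b uv assms x by (intro frac_le mult_left_mono power_mono) auto
          then show ?thesis using len 2 b by auto
        next
          case 3
          have "s < b" using 3 \<delta> f_eq_0[of b n] by (cases "s = b") auto
          moreover have "p ^ k * \<delta> \<le> p ^ k * f n b"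
            using 3 assms by (intro mult_left_mono) auto
          then have "1 \<le> p ^ k * f n b" using k by simp
          ultimately obtain t where t: "t \<in> new_zeros (n + k)" "s < t" "t \<le> b"
            using new_zero_exists[of p s n b k] 3 s assms uv by (auto simp: new_zeros_def)
          have t1: "0 < t" "t \<le> q" using t 3 u1 b uv by auto
          have "b - t \<le> q / (x * b ^ n)" using len t by simp
          also have "\<dots> \<le> q / (x * t ^ n)"
            using t t1 x assms by (intro frac_le mult_left_mono power_mono) auto
          also have "\<dots> = q * t ^ k / x * (1 / t ^ (n + k))"
            using t1 by (simp add: power_add)
          also have "\<dots> \<le> D * (1 / t ^ (n + k))"
            unfolding D_def power_Suc using t1 x assms
            by (intro mult_right_mono divide_right_mono mult_left_mono power_mono) auto
          finally have "b \<in> ?J t" using t by auto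
          moreover have "t \<in> ?N" using t 3 b by auto
          ultimately show ?thesis by blast
        qed simp
      qed
      have "v - u = measure lebesgue {u<..<v}" using uv by simp
      also have "\<dots> \<le> measure lebesgue ((hits n 0 \<delta> u v \<union> ?I) \<union> (\<Union>t\<in>?N. ?J t))"
        using cover fin by (intro measure_mono_fmeasurable fmeasurable.Un fmeasurable.finite_UN) auto
      also have "\<dots> \<le> measure lebesgue (hits n 0 \<delta> u v \<union> ?I) + measure lebesgue (\<Union>t\<in>?N. ?J t)"
        using fin by (intro measure_Un_le) auto
      also have "\<dots> \<le> (measure lebesgue (hits n 0 \<delta> u v) + measure lebesgue ?I)
          + (\<Sum>t\<in>?N. measure lebesgue (?J t))"
        using fin by (intro add_mono measure_Un_le measure_UNION_le) auto
      also have "measure lebesgue (hits n 0 \<delta> u v) \<le> (v - u) / 4"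
      proof -
        have "measure lebesgue (hits n 0 \<delta> u v) \<le> 2 * \<delta> * q / x * cell_weight n u v"
          using u1 uv elim \<delta> by (intro measure_hits_le) auto
        also have "\<dots> \<le> 2 * \<delta> * q / x * (2 * C * (v - u))"
          using elim \<delta> assms x unfolding C_def by (intro mult_left_mono) auto
        also have "\<dots> = (v - u) / 4"
          using C x assms by (simp add: \<delta>_def)
        finally show ?thesis .
      qed
      also have "measure lebesgue ?I \<le> (v - u) / 4"
        using elim x assms by simp
      also have "(\<Sum>t\<in>?N. measure lebesgue (?J t)) = D * (\<Sum>t\<in>?N. 1 / t ^ (n + k))"
        unfolding sum_distrib_left
      proof (rule sum.cong)
        fix t assume "t \<in> ?N"
        then have "0 \<le> D * (1 / t ^ (n + k))" using u1 D by auto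
        then show "measure lebesgue (?J t) = D * (1 / t ^ (n + k))" by simp
      qed simp
      finally show ?case using D by (simp add: field_simps)
    qed
    then show "eventually (\<lambda>n. 1 / (2 * D) * (v - u)
       \<le> (\<Sum>t\<in>new_zeros n \<inter> {u<..<v}. 1 / t ^ n)) sequentially"
      by (rule eventually_sequentially_seg[THEN iffD1])
  qed
qed

section \<open>Lower bounds for hitting a target\<close>

text \<open>Just before \<open>t\<close> the function \<open>b * f (n - 1) b\<close> runs through
the whole unit interval below the integer \<open>t * f (n - 1) t\<close>; the preimage of the target
is an interval whose length is bounded below by the upper slope bound. The set \<open>(z - r, z +
r)\<close> meets \<open>(0,1)\<close> in an interval of length at least \<open>r\<close>, even for
\<open>z\<close> at the boundary.\<close>

lemma hit_before_new_zero:
  assumes "1 < p" "p \<le> u" "t \<in> new_zeros n" "s \<in> Z n" "u < s" "s < t" "v = t \<or> t < v"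
    and "0 \<le> z" "z \<le> 1" "0 \<le> r" "r \<le> 1"
  obtains a b where "u < a" "a \<le> b" "b \<le> t" "Z n \<inter> {a<..<t} = {}"
    "{a<..<b} \<subseteq> hits n z r u v" "r * (p - 1) * (1 / t ^ n) \<le> b - a"
proof -
  have "0 < n" using assms(3) by (cases n) (auto simp: new_zeros_def)
  then obtain m where n: "n = Suc m" by (cases n) auto
  have t: "t \<in> Z (Suc m)" "t \<notin> Z m" using assms by (auto simp: new_zeros_def n)
  have u1: "1 < u" using assms by simp
  define s' where "s' = Max (Z n \<inter> {s..<t})"
  have fin: "finite (Z n \<inter> {s..<t})"
    by (rule finite_subset[OF _ finite_Z[of s n t]]) (use u1 assms in auto)
  have s'_in: "s' \<in> Z n \<inter> {s..<t}"
    unfolding s'_def using assms by (intro Max_in fin) auto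
  have gap: "Z n \<inter> {s'<..<t} = {}"
  proof -
    have "c \<le> s'" if "c \<in> Z n \<inter> {s..<t}" for c
      unfolding s'_def using fin that by (rule Max_ge)
    then show ?thesis using s'_in by fastforce
  qed
  have s': "u < s'" "s' < t" "1 < s'" using s'_in assms by auto
  let ?g = "\<lambda>b. b * f m b"
  have gapm: "Z m \<inter> {s'<..t} = {}"
    using gap t zeros_mono[of m n x] unfolding n by (auto simp: order_le_less)
  have cont: "continuous_on {s'..t} ?g"
    by (rule lift_continuous_on_gap[OF s'(3) gapm])
  have mono: "?g c < ?g d" if "s' \<le> c" "c < d" "d \<le> t" for c d
    by (rule lift_strict_mono_on_gap) (use that s' gapm in auto)
  obtain i j where ij: "?g t = of_int i" "?g s' = of_int j"
    using t s'_in by (auto simp: zeros_Suc_iff n elim!: Ints_cases)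
  with mono[of s' t] s' have "j < i" by simp
  \<comment> \<open>Both values are integers.\<close>
  then have ji: "?g s' \<le> of_int i - 1" unfolding ij by linarith
  define lo where "lo = max 0 (z - r)"
  define hi where "hi = min 1 (z + r)"
  have lohi: "0 \<le> lo" "lo + r \<le> hi" "hi \<le> 1" "z - r \<le> lo" "hi \<le> z + r"
    using assms(8-) by (auto simp: lo_def hi_def)
  obtain a where a: "s' \<le> a" "a \<le> t" "?g a = of_int i - 1 + lo"
    using IVT'[of ?g s' "of_int i - 1 + lo" t] ji ij lohi assms s' cont by auto
  have "continuous_on {a..t} ?g" using cont by (rule continuous_on_subset) (use a in auto)
  then obtain b where b: "a \<le> b" "b \<le> t" "?g b = of_int i - 1 + hi"
    using IVT'[of ?g a "of_int i - 1 + hi" t] a ij lohi assms by auto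
  show thesis
  proof (rule that[of a b])
    show "u < a" "a \<le> b" "b \<le> t" using a b s' by auto
    show "Z n \<inter> {a<..<t} = {}" using gap a by auto
    show "{a<..<b} \<subseteq> hits n z r u v"
    proof
      fix c assume c: "c \<in> {a<..<b}"
      have "?g a < ?g c" "?g c < ?g b"
        by (rule mono; use c a b in simp)+
      then have gc: "of_int i - 1 + lo < ?g c" "?g c < of_int i - 1 + hi"
        using a b by auto
      then have "\<lfloor>?g c\<rfloor> = i - 1" using lohi by (simp add: floor_eq_iff)
      then have "f n c = ?g c - (of_int i - 1)"
        by (simp add: n orbit_Suc)
      then have "\<bar>f n c - z\<bar> < r" using gc lohi by linarith
      moreover have "u < c" "c < v" using c a b s' assms(7) by auto
      ultimately show "c \<in> hits n z r u v" by (simp add: hits_def)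
    qed
    have "r \<le> ?g b - ?g a" using a b lohi by simp
    also have "\<dots> \<le> b ^ n / (b - 1) * (b - a)"
      unfolding n using a b s' gapm by (intro lift_increment) auto
    also have "\<dots> \<le> t ^ n / (p - 1) * (b - a)"
      using a b s' assms by (intro mult_right_mono frac_le power_mono) auto
    finally show "r * (p - 1) * (1 / t ^ n) \<le> b - a"
      using assms s' by (simp add: field_simps)
  qed
qed

text \<open>The intervals given by \<open>hit_before_new_zero\<close> lie in distinct gaps between
zeros and are disjoint. Only the first zero in \<open>(u,v)\<close> can fail to have a predecessor
there, and its weight is at most \<open>1 / u ^ n\<close>.\<close>

lemma measure_hits_ge:
  assumes "1 < p" "p \<le> u" "0 \<le> z" "z \<le> 1" "0 \<le> r" "r \<le> 1"
  shows "r * (p - 1) * ((\<Sum>t\<in>new_zeros n \<inter> {u<..<v}. 1 / t ^ n) - 1 / u ^ n)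
    \<le> measure lebesgue (hits n z r u v)"
proof -
  let ?N = "new_zeros n \<inter> {u<..<v}"
  \<comment> \<open>The new zeros whose preceding gap lies inside \<open>(u,v)\<close>.\<close>
  define T where "T = {t \<in> ?N. Z n \<inter> {u<..<t} \<noteq> {}}"
  have u1: "1 < u" using assms by simp
  have finN: "finite ?N" by (rule finite_new_zeros[OF u1])
  then have finT: "finite T" by (rule finite_subset[rotated]) (auto simp: T_def)
  have "\<forall>t\<in>T. \<exists>a b. u < a \<and> a \<le> b \<and> b \<le> t \<and> Z n \<inter> {a<..<t} = {} \<and>
      {a<..<b} \<subseteq> hits n z r u v \<and> r * (p - 1) * (1 / t ^ n) \<le> b - a"
  proof
    fix t assume "t \<in> T"
    then obtain s where "t \<in> new_zeros n" "t < v" "s \<in> Z n" "u < s" "s < t"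
      by (auto simp: T_def)
    then show "\<exists>a b. u < a \<and> a \<le> b \<and> b \<le> t \<and> Z n \<inter> {a<..<t} = {} \<and>
      {a<..<b} \<subseteq> hits n z r u v \<and> r * (p - 1) * (1 / t ^ n) \<le> b - a"
      using hit_before_new_zero[of p u t n s v z r] assms by metis
  qed
  then obtain a b where ab: "\<And>t. t \<in> T \<Longrightarrow> u < a t \<and> a t \<le> b t \<and> b t \<le> t \<and> Z n \<inter> {a t<..<t} = {} \<and>
      {a t<..<b t} \<subseteq> hits n z r u v \<and> r * (p - 1) * (1 / t ^ n) \<le> b t - a t"
    by metis
  have sep: "disjnt {a t<..<b t} {a t'<..<b t'}" if "t \<in> T" "t' \<in> T" "t < t'" for t t'
  proof -
    have "t \<in> Z n" using that by (auto simp: T_def new_zeros_def)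
    then have "t \<le> a t'" using ab[OF that(2)] that(3) by force
    then show ?thesis using ab[OF that(1)] by (auto simp: disjnt_def)
  qed
  have disj: "pairwise (\<lambda>t t'. disjnt {a t<..<b t} {a t'<..<b t'}) T"
  proof (rule pairwiseI)
    fix t t' assume "t \<in> T" "t' \<in> T" "t \<noteq> t'"
    then show "disjnt {a t<..<b t} {a t'<..<b t'}"
      using sep[of t t'] sep[of t' t] by (cases "t < t'") (auto simp: disjnt_sym)
  qed
  have first: "(\<Sum>t\<in>?N - T. 1 / t ^ n) \<le> 1 / u ^ n"
  proof (cases "?N - T = {}")
    case True
    then show ?thesis using u1 by (simp only: sum.empty) simp
  next
    case False
    then obtain t where t: "t \<in> ?N - T" by blast
    have "t' = t" if "t' \<in> ?N - T" for t'
    proof (rule ccontr)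
      assume "t' \<noteq> t"
      then consider "t' < t" | "t < t'" by linarith
      then show False
        by cases (use that t in \<open>auto simp: T_def new_zeros_def\<close>)
    qed
    then have "?N - T = {t}" using t by blast
    moreover have "1 / t ^ n \<le> 1 / u ^ n" using t u1 by (intro frac_le power_mono) auto
    ultimately show ?thesis by (simp only:) simp
  qed
  have "(\<Sum>t\<in>?N. 1 / t ^ n) = (\<Sum>t\<in>?N - T. 1 / t ^ n) + (\<Sum>t\<in>T. 1 / t ^ n)"
    using finN by (intro sum.subset_diff) (auto simp: T_def)
  with first have "(\<Sum>t\<in>?N. 1 / t ^ n) - 1 / u ^ n \<le> (\<Sum>t\<in>T. 1 / t ^ n)" by simp
  then have "r * (p - 1) * ((\<Sum>t\<in>?N. 1 / t ^ n) - 1 / u ^ n) \<le> r * (p - 1) * (\<Sum>t\<in>T. 1 / t ^ n)"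
    using assms by (intro mult_left_mono) auto
  also have "\<dots> = (\<Sum>t\<in>T. r * (p - 1) * (1 / t ^ n))"
    by (rule sum_distrib_left)
  also have "\<dots> \<le> (\<Sum>t\<in>T. measure lebesgue {a t<..<b t})"
    using ab by (intro sum_mono) simp
  also have "\<dots> = measure lebesgue (\<Union>t\<in>T. {a t<..<b t})"
    by (rule measure_UNION'[symmetric]) (use finT disj in auto)
  also have "\<dots> \<le> measure lebesgue (hits n z r u v)"
    using ab finT by (intro measure_mono_fmeasurable) (auto intro!: sets.finite_UN)
  finally show ?thesis .
qed

lemma eventually_measure_hits_ge:
  assumes "1 < p" "p < q"
  obtains c where "0 < c" "\<And>u v. \<lbrakk>p \<le> u; u < v; v \<le> q\<rbrakk> \<Longrightarrow>
     eventually (\<lambda>n. \<forall>z r. 0 \<le> z \<longrightarrow> z \<le> 1 \<longrightarrow> 0 \<le> r \<longrightarrow> r \<le> 1 \<longrightarrow>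
        c * r * (v - u) \<le> measure lebesgue (hits n z r u v)) sequentially"
proof -
  obtain c where c: "0 < c" "\<And>u v. \<lbrakk>p \<le> u; u < v; v \<le> q\<rbrakk> \<Longrightarrow>
     eventually (\<lambda>n. c * (v - u) \<le> (\<Sum>t\<in>new_zeros n \<inter> {u<..<v}. 1 / t ^ n)) sequentially"
    using eventually_new_zeros_sum_ge[OF assms] by blast
  show thesis
  proof (rule that[of "(p - 1) * (c / 2)"])
    show "0 < (p - 1) * (c / 2)" using c assms by simp
    fix u v assume uv: "p \<le> u" "u < v" "v \<le> q"
    have "0 < c / 2 * (v - u)" using uv c by simp
    moreover have "1 < u" using uv assms by simp
    ultimately have "eventually (\<lambda>n. 1 / u ^ n < c / 2 * (v - u)) sequentially"
      using arith_geometric_tendsto_0(2)[of u 1] order_tendstoD(2) by blast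
    then show "eventually (\<lambda>n. \<forall>z r. 0 \<le> z \<longrightarrow> z \<le> 1 \<longrightarrow> 0 \<le> r \<longrightarrow> r \<le> 1 \<longrightarrow>
        (p - 1) * (c / 2) * r * (v - u) \<le> measure lebesgue (hits n z r u v)) sequentially"
      using c(2)[OF uv]
    proof eventually_elim
      case (elim n)
      show ?case
      proof (intro allI impI)
        fix z r :: real assume zr: "0 \<le> z" "z \<le> 1" "0 \<le> r" "r \<le> 1"
        have "(p - 1) * (c / 2) * r * (v - u) = r * (p - 1) * (c / 2 * (v - u))" by simp
        also have "\<dots> \<le> r * (p - 1) * ((\<Sum>t\<in>new_zeros n \<inter> {u<..<v}. 1 / t ^ n) - 1 / u ^ n)"
          using elim zr assms by (intro mult_left_mono) auto
        also have "\<dots> \<le> measure lebesgue (hits n z r u v)"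
          using zr uv assms by (intro measure_hits_ge) auto
        finally show "(p - 1) * (c / 2) * r * (v - u) \<le> measure lebesgue (hits n z r u v)" .
      qed
    qed
  qed
qed

section \<open>Almost every base\<close>

text \<open>Replacing the radius \<open>b powr (- l n)\<close> by the smaller \<open>q powr (- l
n)\<close> makes the target independent of the base and keeps the series divergent.\<close>

lemma almost_all_hit:
  assumes "1 < p" "p < q"
    and xs: "\<And>n. n \<ge> 1 \<Longrightarrow> xs n \<in> {0..1}" and l: "\<And>n. n \<ge> 1 \<Longrightarrow> 0 \<le> l n"
    and div: "power_sum l q = \<infinity>"
  shows "{p<..<q} - shrinking_params x xs l \<in> null_sets lebesgue"
proof -
  let ?E = "shrinking_params x xs l"
  define r where "r n = q powr (- l n)" for n
  define h where "h k = (real k + 1) / p ^ k" for k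
  obtain c where c: "0 < c" "\<And>u v. \<lbrakk>p \<le> u; u < v; v \<le> q\<rbrakk> \<Longrightarrow>
     eventually (\<lambda>n. \<forall>z r. 0 \<le> z \<longrightarrow> z \<le> 1 \<longrightarrow> 0 \<le> r \<longrightarrow> r \<le> 1 \<longrightarrow>
        c * r * (v - u) \<le> measure lebesgue (hits n z r u v)) sequentially"
    using eventually_measure_hits_ge[OF assms(1,2)] by blast
  define C where "C = p / (p - 1)^2"
  define D where "D = max 1 (C * (2 * q / x))"
  define K where "K = 2 * q / x * D * (2 * C)"
  have pos: "0 < C" "1 \<le> D" "0 < K"
    using assms x by (auto simp: C_def D_def K_def)
  have r: "0 \<le> r n" for n by (simp add: r_def)
  have r1: "r n \<le> 1" if "1 \<le> n" for n
  proof -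
    have "q powr (- l n) \<le> q powr 0" using assms that by (intro powr_mono) auto
    then show ?thesis using assms by (simp add: r_def)
  qed
  have nsum: "\<not> summable r"
  proof
    assume "summable r"
    then have "summable (\<lambda>n. q powr (- l (Suc n)))"
      using summable_Suc_iff[of r] by (simp add: r_def)
    then show False using div power_sum_finite_iff[of l q] by simp
  qed
  show ?thesis
  proof (rule null_if_complement_proportional)
    show "{p<..<q} - ?E \<in> sets lebesgue" using shrinking_params_borel[of x xs l] by auto
    show "{p<..<q} - ?E \<subseteq> {p<..<q}" by auto
    show "0 < c\<^sup>2 / (4 * K)" using c pos by simp
    fix u v assume uv: "p \<le> u" "u < v" "v \<le> q"
    define A where "A n = hits n (xs n) (r n) u v" for n
    have "(c * (v - u))\<^sup>2 / (4 * (K * (v - u))) \<le> measure lebesgue (limsup A)"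
    proof (rule measure_limsup_ge[where r = r and h = h and J = "{u..v}"])
      show "A n \<in> sets lebesgue" "A n \<subseteq> {u..v}" for n
        by (auto simp: A_def) (auto simp: hits_def)
      show "{u..v} \<in> lmeasurable" by simp
      show "0 \<le> r n" "\<not> summable r" for n by (rule r nsum)+
      show "0 \<le> h k" "summable h" for k
        using summable_arith_geometric[OF assms(1)] assms unfolding h_def by auto
      show "0 < c * (v - u)" "0 < K * (v - u)" using c pos uv by auto
      show "eventually (\<lambda>n. c * (v - u) * r n \<le> measure lebesgue (A n)) sequentially"
        using c(2)[OF uv] eventually_ge_at_top[of 1]
      proof eventually_elim
        case (elim n)
        then have "c * r n * (v - u) \<le> measure lebesgue (A n)"
          using r[of n] r1[of n] xs[of n] by (auto simp: A_def)
        then show ?case by (simp add: mult_ac)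
      qed
      show "eventually (\<lambda>m. \<forall>k. measure lebesgue (A m \<inter> A (m + k))
          \<le> K * (v - u) * r (m + k) * (r m + h k)) sequentially"
        using eventually_cell_weight_le[OF assms(1) uv(1,2)] eventually_ge_at_top[of 1]
      proof eventually_elim
        case (elim m)
        show ?case
        proof
          fix k
          have h0: "0 \<le> h k" using assms by (simp add: h_def)
          have "C * (2 * q / x) * r m + 1 * h k \<le> D * r m + D * h k"
            using r[of m] h0 pos by (intro add_mono mult_right_mono) (auto simp: D_def)
          then have Dle: "C * (2 * r m * q / x) + h k \<le> D * (r m + h k)"
            by (simp add: algebra_simps)
          have nn: "0 \<le> 2 * r (m + k) * q / x" "0 \<le> D * (r m + h k)"
            using r h0 pos assms x by auto
          have "measure lebesgue (A m \<inter> A (m + k))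
              \<le> 2 * r (m + k) * q / x * (C * (2 * r m * q / x) + h k) * cell_weight m u v"
            unfolding A_def C_def h_def using elim uv assms r by (intro measure_hits_Int_le) auto
          also have "\<dots> \<le> 2 * r (m + k) * q / x * (D * (r m + h k)) * (2 * C * (v - u))"
          proof (rule mult_mono)
            show "2 * r (m + k) * q / x * (C * (2 * r m * q / x) + h k) \<le> 2 * r (m + k) * q / x * (D * (r m + h k))"
              by (intro mult_left_mono Dle nn)
            show "cell_weight m u v \<le> 2 * C * (v - u)" using elim by (simp add: C_def)
            show "0 \<le> 2 * r (m + k) * q / x * (D * (r m + h k))" using nn by (rule mult_nonneg_nonneg)
            show "0 \<le> cell_weight m u v" unfolding cell_weight_def using uv assms by (intro sum_nonneg) auto
          qed
          also have "\<dots> = K * (v - u) * r (m + k) * (r m + h k)"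
            by (simp add: K_def)
          finally show "measure lebesgue (A m \<inter> A (m + k)) \<le> K * (v - u) * r (m + k) * (r m + h k)" .
        qed
      qed
    qed
    also have "(c * (v - u))\<^sup>2 / (4 * (K * (v - u))) = c\<^sup>2 / (4 * K) * (v - u)"
      using uv by (simp add: power2_eq_square)
    also have "measure lebesgue (limsup A) \<le> measure lebesgue ({u<..<v} - ({p<..<q} - ?E))"
    proof (rule measure_mono_fmeasurable)
      show "limsup A \<subseteq> {u<..<v} - ({p<..<q} - ?E)"
      proof
        fix b assume "b \<in> limsup A"
        then have b: "\<exists>n\<ge>m. b \<in> A n" for m by (auto simp: limsup_INF_SUP)
        have ub: "u < b" "b < v" using b[of 0] by (auto simp: A_def hits_def)
        have "\<exists>n\<ge>m. 1 \<le> n \<and> \<bar>f n b - xs n\<bar> < b powr (- l n)" for m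
        proof -
          obtain n where n: "n \<ge> max m 1" "b \<in> A n" using b by blast
          then have "r n \<le> b powr (- l n)"
            unfolding r_def using ub uv assms by (intro powr_neg_antimono) auto
          then show ?thesis using n by (intro exI[of _ n]) (auto simp: A_def hits_def)
        qed
        then have "b \<in> ?E" using ub uv assms by (auto simp: shrinking_params_eq)
        then show "b \<in> {u<..<v} - ({p<..<q} - ?E)" using ub by simp
      qed
      show "limsup A \<in> sets lebesgue"
        by (intro measurable_limsup) (simp add: A_def)
      show "{u<..<v} - ({p<..<q} - ?E) \<in> lmeasurable"
        using shrinking_params_borel[of x xs l] by (intro fmeasurable_Diff) auto
    qed
    finally show "c\<^sup>2 / (4 * K) * (v - u) \<le> measure lebesgue ({u<..<v} - ({p<..<q} - ?E))" .
  qed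
qed

text \<open>Here the radius is enlarged to \<open>p powr (- l n)\<close>, and the ordinary
Borel--Cantelli lemma applies.\<close>

lemma almost_none_hit:
  assumes "1 < p" "p < q" and l: "\<And>n. n \<ge> 1 \<Longrightarrow> 0 \<le> l n"
    and conv: "power_sum l p < \<infinity>"
  shows "{p<..<q} \<inter> shrinking_params x xs l \<in> null_sets lebesgue"
proof -
  define r where "r n = p powr (- l (Suc n))" for n
  define A where "A n = hits (Suc n) (xs (Suc n)) (r n) p q" for n
  let ?K = "2 * q / x * (2 * (p / (p - 1)^2) * (q - p))"
  have "limsup A \<in> null_sets lebesgue"
  proof (rule borel_cantelli_limsup1)
    show "A n \<in> sets lebesgue" for n by (simp add: A_def)
    show "emeasure lebesgue (A n) < \<infinity>" for n
      using hits_lmeasurable[of "Suc n" "xs (Suc n)" "r n" p q] by (auto simp: A_def fmeasurable_def)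
    have "eventually (\<lambda>n. cell_weight (Suc n) p q \<le> 2 * (p / (p - 1)^2) * (q - p)) sequentially"
      using eventually_cell_weight_le[OF assms(1) order_refl assms(2)]
      by (rule eventually_sequentially_Suc[THEN iffD2])
    then have "eventually (\<lambda>n. norm (measure lebesgue (A n)) \<le> ?K * r n) sequentially"
    proof eventually_elim
      case (elim n)
      have "measure lebesgue (A n) \<le> 2 * r n * q / x * cell_weight (Suc n) p q"
        unfolding A_def using assms by (intro measure_hits_le) (auto simp: r_def)
      also have "\<dots> \<le> 2 * r n * q / x * (2 * (p / (p - 1)^2) * (q - p))"
        using assms x by (intro mult_left_mono[OF elim]) (auto simp: r_def)
      finally show ?case by (simp add: mult_ac)
    qed
    moreover have "summable (\<lambda>n. ?K * r n)"
      using conv unfolding power_sum_finite_iff r_def by (rule summable_mult)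
    ultimately show "summable (\<lambda>n. measure lebesgue (A n))"
      by (rule summable_comparison_test_ev)
  qed
  moreover have "{p<..<q} \<inter> shrinking_params x xs l \<subseteq> limsup A"
  proof
    fix b assume b: "b \<in> {p<..<q} \<inter> shrinking_params x xs l"
    have "\<exists>n\<ge>m. b \<in> A n" for m
    proof -
      obtain n where n: "n \<ge> Suc m" "\<bar>f n b - xs n\<bar> < b powr (- l n)"
        using b by (auto simp: shrinking_params_eq)
      then obtain k where k: "n = Suc k" "m \<le> k" by (cases n) auto
      have "b powr (- l n) \<le> p powr (- l n)"
        using b assms k by (intro powr_neg_antimono) auto
      then have "b \<in> A k" using n b k by (auto simp: A_def hits_def r_def)
      then show ?thesis using k by auto
    qed
    then show "b \<in> limsup A" by (auto simp: limsup_INF_SUP)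
  qed
  moreover have "{p<..<q} \<inter> shrinking_params x xs l \<in> sets lebesgue"
    using shrinking_params_borel[of x xs l] by auto
  ultimately show ?thesis by (meson null_sets_subset)
qed

lemma full_below_beta_star:
  assumes "\<And>n. n \<ge> 1 \<Longrightarrow> xs n \<in> {0..1}" "\<And>n. n \<ge> 1 \<Longrightarrow> 0 \<le> l n"
  shows "{b. 1 < b \<and> ereal b < beta_star l} - shrinking_params x xs l \<in> null_sets lebesgue"
proof -
  let ?E = "shrinking_params x xs l"
  let ?I = "{(p, q). p \<in> \<rat> \<and> q \<in> \<rat> \<and> 1 < p \<and> p < q \<and> ereal q < beta_star l}"
  have "countable ?I"
    by (rule countable_subset[OF _ countable_SIGMA[OF countable_rat countable_rat]]) auto
  then have "(\<Union>i\<in>?I. {fst i<..<snd i} - ?E) \<in> null_sets lebesgue"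
    using almost_all_hit power_sum_below_beta_star assms by (intro null_sets_UN') fastforce+
  moreover have "{b. 1 < b \<and> ereal b < beta_star l} - ?E \<subseteq> (\<Union>i\<in>?I. {fst i<..<snd i} - ?E)"
  proof
    fix b assume b: "b \<in> {b. 1 < b \<and> ereal b < beta_star l} - ?E"
    obtain p where p: "p \<in> \<rat>" "1 < p" "p < b" using b Rats_dense_in_real[of 1 b] by auto
    obtain y where y: "ereal b < ereal y" "ereal y < beta_star l"
      using b ereal_dense2[of "ereal b" "beta_star l"] by blast
    then obtain q where q: "q \<in> \<rat>" "b < q" "q < y" using Rats_dense_in_real[of b y] by auto
    have "ereal q < beta_star l" using q(3) y(2) by (meson less_ereal.simps(1) order.strict_trans)
    then have "(p, q) \<in> ?I" using p q by simp
    then show "b \<in> (\<Union>i\<in>?I. {fst i<..<snd i} - ?E)" using p q b by force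
  qed
  moreover have "{b. 1 < b \<and> ereal b < beta_star l} - ?E \<in> sets lebesgue"
  proof -
    have "{b. 1 < b \<and> ereal b < beta_star l} \<in> sets borel" by measurable
    then show ?thesis using shrinking_params_borel[of x xs l] by auto
  qed
  ultimately show ?thesis by (meson null_sets_subset)
qed

lemma null_above_beta_star:
  assumes "\<And>n. n \<ge> 1 \<Longrightarrow> 0 \<le> l n"
  shows "{b. 1 < b \<and> beta_star l < ereal b} \<inter> shrinking_params x xs l \<in> null_sets lebesgue"
proof -
  let ?E = "shrinking_params x xs l"
  let ?I = "{(p, q). p \<in> \<rat> \<and> q \<in> \<rat> \<and> 1 < p \<and> p < q \<and> beta_star l < ereal p}"
  have "countable ?I"
    by (rule countable_subset[OF _ countable_SIGMA[OF countable_rat countable_rat]]) auto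
  then have "(\<Union>i\<in>?I. {fst i<..<snd i} \<inter> ?E) \<in> null_sets lebesgue"
    using almost_none_hit power_sum_above_beta_star assms by (intro null_sets_UN') fastforce+
  moreover have "{b. 1 < b \<and> beta_star l < ereal b} \<inter> ?E \<subseteq> (\<Union>i\<in>?I. {fst i<..<snd i} \<inter> ?E)"
  proof
    fix b assume b: "b \<in> {b. 1 < b \<and> beta_star l < ereal b} \<inter> ?E"
    obtain y where y: "beta_star l < ereal y" "ereal y < ereal b"
      using b ereal_dense2[of "beta_star l" "ereal b"] by blast
    then obtain p where p: "p \<in> \<rat>" "max 1 y < p" "p < b" using b Rats_dense_in_real[of "max 1 y" b] by auto
    obtain q where q: "q \<in> \<rat>" "b < q" using Rats_dense_in_real[of b "b + 1"] by auto
    have "beta_star l < ereal p" using p(2) y(1) by (meson less_ereal.simps(1) max_less_iff_conj order.strict_trans)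
    then have "(p, q) \<in> ?I" using p q by simp
    then show "b \<in> (\<Union>i\<in>?I. {fst i<..<snd i} \<inter> ?E)" using p q b by force
  qed
  moreover have "{b. 1 < b \<and> beta_star l < ereal b} \<inter> ?E \<in> sets lebesgue"
  proof -
    have "{b. 1 < b \<and> beta_star l < ereal b} \<in> sets borel" by measurable
    then show ?thesis using shrinking_params_borel[of x xs l] by auto
  qed
  ultimately show ?thesis by (meson null_sets_subset)
qed

end

theorem corollary1p4:
  fixes xs l :: "nat \<Rightarrow> real" and x :: real
  assumes "\<And>n. n \<ge> 1 \<Longrightarrow> xs n \<in> {0..1}"
    and "\<And>n. n \<ge> 1 \<Longrightarrow> l n \<ge> 0"
    and "x \<in> {0<..1}"
  shows "beta_star l = beta_star_sup l \<and>
    shrinking_params x xs l \<in> sets lebesgue \<and>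
    (if beta_star l = \<infinity>
     then emeasure lebesgue ({1<..} - shrinking_params x xs l) = 0
     else enn2ereal (emeasure lebesgue (shrinking_params x xs l)) = beta_star l - 1)"
proof (intro conjI)
  interpret beta_orbit x by standard (use assms(3) in auto)
  let ?E = "shrinking_params x xs l"
  show "beta_star l = beta_star_sup l" using assms(2) by (rule beta_star_eq_sup)
  show E: "?E \<in> sets lebesgue" using shrinking_params_borel[of x xs l] by simp
  have below: "{b. 1 < b \<and> ereal b < beta_star l} - ?E \<in> null_sets lebesgue"
    using assms(1,2) by (rule full_below_beta_star)
  show "if beta_star l = \<infinity> then emeasure lebesgue ({1<..} - ?E) = 0
     else enn2ereal (emeasure lebesgue ?E) = beta_star l - 1"
  proof (cases "beta_star l = \<infinity>")
    case True
    have "{b. 1 < b \<and> ereal b < beta_star l} = {1<..}" using True by auto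
    then show ?thesis using null_setsD1[OF below] True by simp
  next
    case False
    have "1 \<le> beta_star l"
      unfolding beta_star_def by (intro Inf_greatest) (auto simp: one_ereal_def)
    with False obtain B where B: "beta_star l = ereal B" "1 \<le> B"
      by (cases "beta_star l") (auto simp: one_ereal_def)
    have "{1<..<B} - ?E \<in> null_sets lebesgue"
      using below B by (simp add: greaterThanLessThan_def greaterThan_def lessThan_def Int_def)
    moreover have "{b. 1 < b \<and> B < b} \<inter> ?E \<in> null_sets lebesgue"
      using null_above_beta_star[of l xs] assms(2) B by simp
    moreover have "{B} \<in> null_sets lebesgue" by (simp add: negligible_iff_null_sets[symmetric])
    ultimately have "AE b in lebesgue. b \<notin> {1<..<B} - ?E \<and> b \<notin> {b. 1 < b \<and> B < b} \<inter> ?E \<and> b \<notin> {B}"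
      by (intro AE_conjI AE_not_in)
    then have "AE b in lebesgue. b \<in> ?E \<longleftrightarrow> b \<in> {1<..<B}"
      by eventually_elim (auto simp: shrinking_params_def)
    then have "emeasure lebesgue ?E = emeasure lebesgue {1<..<B}"
      using E by (intro emeasure_eq_AE) auto
    also have "\<dots> = ennreal (B - 1)" using B by simp
    finally show ?thesis using B by (simp add: one_ereal_def)
  qed
qed

end
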